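(* Let $m>1$ and $\ell\ge1$ be integers, $\mathcal{A}_\ell=\{0,1,\dots,m-1\}^\ell$, and let $q_1(\cdot)<\dots<q_\ell(\cdot)$ be functions as in the context with $q_1(k)=k$ for all $k$. Let $P=(p_{\alpha\beta},\ \alpha,\beta\in\mathcal{A}_\ell)$ be a nonnegative matrix with $\sum_{\alpha,\beta}p_{\alpha\beta}=1$ and suppose that there exists a nonnegative matrix $R=(r_{ij};\ i,j=0,1,\dots,m-1)$ satisfying: (i) some power of $R$ is a positive matrix; (ii) $\sum_{i,j}r_{ij}=1$ and $q_i:=\sum_{j=0}^{m-1}r_{ij}=\sum_{j=0}^{m-1}r_{ji}$ for every $i$; (iii) $p_{\alpha\beta}=\prod_{i=1}^\ell r_{\alpha_i\beta_i}$ for all $\alpha=(\alpha_1,\dots,\alpha_\ell),\ \beta=(\beta_1,\dots,\beta_\ell)\in\mathcal{A}_\ell$. Then $q=(q_0,q_1,\dots,q_{m-1})$ is a positive stationary vector of the $m\times m$ irreducible aperiodic probability matrix $Q=(q_{ij})$, $q_{ij}=q_i^{-1}r_{ij}$, and, under the convention $0\ln0=0$, the set $$U_P=\Big\{x\in(0,1):\ \lim_{n\to\infty}\tfrac1nN_{\alpha,\beta}(x,n)=p_{\alpha\beta}\ \text{ for all }\alpha,\beta\in\mathcal{A}_\ell\Big\}$$ has Hausdorff dimension $$HD(U_P)=\frac{-\sum_{i,j=0}^{m-1}q_iq_{ij}\ln q_{ij}}{\ln m}.$$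
   Context: For $x\in[0,1)$ let $x=\sum_{i=1}^\infty a_{i-1}(x)m^{-i}$, $a_j(x)\in\{0,\dots,m-1\}$, $j=0,1,\dots$, be its base-$m$ expansion (tails consisting only of the digit $m-1$ are not allowed). For $\alpha,\beta\in\mathcal{A}_\ell$, $$N_{\alpha,\beta}(x,n)=\#\{k:\ 0<k\le n,\ (a_{q_1(k)}(x),\dots,a_{q_\ell(k)}(x))=\alpha\text{ and }(a_{q_1(k)+1}(x),\dots,a_{q_\ell(k)+1}(x))=\beta\}.$$ The functions $q_1(n)<q_2(n)<\dots<q_\ell(n)$ (not to be confused with the numbers $q_i$, $q_{ij}$) are positive, take integer values on integers, and for some $\varepsilon\in(0,1]$ and all $n\ge1$ satisfy $q_i(n)\ge q_{i-1}(n)+\varepsilon n$ for $i=2,\dots,\ell$ and $q_i(n+1)\ge q_i(n)+\varepsilon$ for $i=1,\dots,\ell$. A probability matrix is a nonnegative matrix whose rows sum to 1; a stationary vector of $Q$ is a probability vector $q$ with $qQ=q$. $HD$ denotes Hausdorff dimension. *)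

theory Defs
  imports "HOL-Analysis.Analysis" "Jordan_Normal_Form.Matrix"
begin

section \<open>Hausdorff dimension\<close>

text \<open>The \<open>s\<close>-th power of the diameter of a covering set. For \<open>s = 0\<close> every nonempty set
  has weight 1 (in HOL, \<open>0 powr 0 = 0\<close>, so \<open>powr\<close> alone would be wrong for singletons).\<close>

definition diam_weight :: "real \<Rightarrow> 'a::metric_space set \<Rightarrow> ennreal" where
  "diam_weight s U =
     (if U = {} then 0 else if s = 0 then 1 else ennreal (diameter U powr s))"

text \<open>The library function \<open>diameter\<close> is meaningful on bounded sets only, hence the explicit
  boundedness requirement on covers.\<close>

definition delta_covers :: "real \<Rightarrow> 'a::metric_space set \<Rightarrow> (nat \<Rightarrow> 'a set) set" where
  "delta_covers \<delta> A =
     {U. A \<subseteq> (\<Union>i. U i) \<and> (\<forall>i. bounded (U i) \<and> diameter (U i) \<le> \<delta>)}"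

definition hausdorff_pre_measure :: "real \<Rightarrow> real \<Rightarrow> 'a::metric_space set \<Rightarrow> ennreal" where
  "hausdorff_pre_measure s \<delta> A = (INF U\<in>delta_covers \<delta> A. \<Sum>i. diam_weight s (U i))"

definition hausdorff_measure :: "real \<Rightarrow> 'a::metric_space set \<Rightarrow> ennreal" where
  "hausdorff_measure s A = (SUP \<delta>\<in>{0<..}. hausdorff_pre_measure s \<delta> A)"

definition hausdorff_dim :: "'a::metric_space set \<Rightarrow> ereal" where
  "hausdorff_dim A = (INF s\<in>{s. 0 \<le> s \<and> hausdorff_measure s A = 0}. ereal s)"

section \<open>Base-\<open>m\<close> expansions\<close>

definition is_base_expansion :: "nat \<Rightarrow> real \<Rightarrow> (nat \<Rightarrow> nat) \<Rightarrow> bool" where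
  "is_base_expansion m x a \<longleftrightarrow>
     (\<forall>j. a j < m) \<and>
     (\<lambda>j. real (a j) / real m ^ (j + 1)) sums x \<and>
     \<not> (\<exists>N. \<forall>j\<ge>N. a j = m - 1)"

text \<open>\<open>digit m x j\<close> is the coefficient of \<open>1 / m ^ (j + 1)\<close>. It is well defined for \<open>m > 1\<close> and
  \<open>x \<in> [0,1)\<close> by lemma \<open>ex1_base_expansion\<close> below.\<close>

definition digit :: "nat \<Rightarrow> real \<Rightarrow> nat \<Rightarrow> nat" where
  "digit m x = (THE a. is_base_expansion m x a)"

lemma sums_top_digits:
  assumes "m > (1::nat)"
  shows "(\<lambda>j. real (m - 1) / real m ^ (j + 1)) sums 1"
proof -
  have "(\<lambda>j. (1 / real m) ^ j) sums (1 / (1 - 1 / real m))"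
    using assms by (intro geometric_sums) auto
  from sums_mult[OF this, of "real (m - 1) / real m"]
  show ?thesis using assms by (simp add: field_simps power_divide of_nat_diff)
qed

lemma base_expansion_floor:
  assumes m: "m > 1" and a: "is_base_expansion m x a"
  shows "int (a n) = \<lfloor>real m ^ (n + 1) * x\<rfloor> - int m * \<lfloor>real m ^ n * x\<rfloor>"
proof -
  define S where "S n = (\<Sum>i<n. int (a i) * int m ^ (n - 1 - i))" for n
  have sums: "(\<lambda>j. real (a j) / real m ^ (j + 1)) sums x" and lt: "a j < m" for j
    using a by (auto simp: is_base_expansion_def)
  have S_Suc: "S (Suc n) = int m * S n + int (a n)" for n
  proof -
    have "(\<Sum>i<n. int (a i) * int m ^ (n - i)) = (\<Sum>i<n. int m * (int (a i) * int m ^ (n - 1 - i)))"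
    proof (rule sum.cong)
      fix i assume "i \<in> {..<n}"
      then have "n - i = Suc (n - 1 - i)" by auto
      then show "int (a i) * int m ^ (n - i) = int m * (int (a i) * int m ^ (n - 1 - i))"
        by simp
    qed simp
    then show ?thesis by (simp add: S_def sum_distrib_left)
  qed
  have S_real: "real_of_int (S n) = real m ^ n * (\<Sum>i<n. real (a i) / real m ^ (i + 1))" for n
  proof (induction n)
    case 0 then show ?case by (simp add: S_def)
  next
    case (Suc n)
    then show ?case using m by (simp add: S_Suc field_simps)
  qed
  have floor_eq: "\<lfloor>real m ^ n * x\<rfloor> = S n" for n
  proof -
    define T where "T = real m ^ n * x - real_of_int (S n)"
    have "(\<lambda>i. real (a (i + n)) / real m ^ (i + n + 1)) sums
            (x - (\<Sum>i<n. real (a i) / real m ^ (i + 1)))"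
      using sums_split_initial_segment[OF sums, of n] by simp
    from sums_mult[OF this, of "real m ^ n"]
    have T: "(\<lambda>i. real (a (i + n)) / real m ^ (i + 1)) sums T"
      using m by (simp add: T_def S_real right_diff_distrib power_add)
    have "T \<ge> 0" by (rule sums_le[OF _ sums_zero T]) simp
    have D: "(\<lambda>i. real (m - 1) / real m ^ (i + 1) - real (a (i + n)) / real m ^ (i + 1)) sums (1 - T)"
      by (rule sums_diff[OF sums_top_digits[OF m] T])
    obtain j where j: "j \<ge> n" "a j \<noteq> m - 1"
      using a by (auto simp: is_base_expansion_def)
    have le: "a i \<le> m - 1" for i using lt[of i] m by linarith
    have aj: "a j < m - 1" using j le[of j] by linarith
    have "0 < (\<Sum>i. real (m - 1) / real m ^ (i + 1) - real (a (i + n)) / real m ^ (i + 1))"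
    proof (rule suminf_pos2[where i = "j - n"])
      show "summable (\<lambda>i. real (m - 1) / real m ^ (i + 1) - real (a (i + n)) / real m ^ (i + 1))"
        using D by (simp add: sums_iff)
      show "0 \<le> real (m - 1) / real m ^ (i + 1) - real (a (i + n)) / real m ^ (i + 1)" for i
        using le[of "i + n"] by (simp add: divide_right_mono)
      show "0 < real (m - 1) / real m ^ (j - n + 1) - real (a (j - n + n)) / real m ^ (j - n + 1)"
        using j aj m by (simp add: divide_strict_right_mono)
    qed
    then have "T < 1" using D by (simp add: sums_iff)
    with \<open>T \<ge> 0\<close> show ?thesis unfolding T_def by linarith
  qed
  show ?thesis using floor_eq[of n] floor_eq[of "n + 1"] S_Suc[of n] by simp
qed

lemma ex1_base_expansion:
  assumes m: "m > 1" and x: "x \<in> {0..<1}"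
  shows "\<exists>!a. is_base_expansion m x a"
proof (rule ex_ex1I)
  define f where "f n = \<lfloor>real m ^ n * x\<rfloor>" for n
  define a where "a n = nat (f (n + 1) - int m * f n)" for n
  have f: "real_of_int (f n) \<le> real m ^ n * x" "real m ^ n * x < real_of_int (f n) + 1" for n
    unfolding f_def by linarith+
  have nonneg: "f (n + 1) - int m * f n \<ge> 0" for n
  proof -
    have "real m * real_of_int (f n) \<le> real m * (real m ^ n * x)"
      using f(1)[of n] by (intro mult_left_mono) auto
    also have "\<dots> < real_of_int (f (n + 1)) + 1" using f(2)[of "n + 1"] by (simp add: mult.assoc)
    finally have "real_of_int (int m * f n) < real_of_int (f (n + 1) + 1)" by simp
    then have "int m * f n < f (n + 1) + 1" by (simp only: of_int_less_iff)
    then show ?thesis by linarith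
  qed
  have less: "f (n + 1) - int m * f n < int m" for n
  proof -
    have "real_of_int (f (n + 1)) \<le> real m * (real m ^ n * x)"
      using f(1)[of "n + 1"] by (simp add: mult.assoc)
    also have "\<dots> < real m * (real_of_int (f n) + 1)"
      using f(2)[of n] m by (intro mult_strict_left_mono) auto
    finally have "real_of_int (f (n + 1)) < real_of_int (int m * (f n + 1))" by simp
    then have "f (n + 1) < int m * (f n + 1)" by (simp only: of_int_less_iff)
    then show ?thesis by (simp add: algebra_simps)
  qed
  have f0: "f 0 = 0" using x unfolding f_def by (simp add: floor_eq_iff)
  have a_real: "real (a n) = real_of_int (f (n + 1)) - real m * real_of_int (f n)" for n
    using nonneg[of n] by (simp add: a_def)
  have partial: "(\<Sum>i<n. real (a i) / real m ^ (i + 1)) = real_of_int (f n) / real m ^ n" for n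
  proof (induction n)
    case 0 then show ?case by (simp add: f0)
  next
    case (Suc n) then show ?case using m by (simp add: a_real field_simps)
  qed
  have lim: "(\<lambda>n. real_of_int (f n) / real m ^ n) \<longlonglongrightarrow> x"
  proof (rule tendsto_sandwich)
    have "(\<lambda>n. (1 / real m) ^ n) \<longlonglongrightarrow> 0" using m by (intro LIMSEQ_power_zero) auto
    then show "(\<lambda>n. x - (1 / real m) ^ n) \<longlonglongrightarrow> x"
      using tendsto_diff[OF tendsto_const[of x]] by fastforce
    show "\<forall>\<^sub>F n in sequentially. x - (1 / real m) ^ n \<le> real_of_int (f n) / real m ^ n"
    proof (rule always_eventually, rule allI)
      fix n
      show "x - (1 / real m) ^ n \<le> real_of_int (f n) / real m ^ n"
      proof -
        have "real m ^ n * x / real m ^ n \<le> (real_of_int (f n) + 1) / real m ^ n"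
          using f(2)[of n] by (intro divide_right_mono) auto
        then show ?thesis using m by (simp add: add_divide_distrib power_divide)
      qed
    qed
    show "\<forall>\<^sub>F n in sequentially. real_of_int (f n) / real m ^ n \<le> x"
    proof (rule always_eventually, rule allI)
      fix n
      show "real_of_int (f n) / real m ^ n \<le> x"
        using f(1)[of n] m by (simp add: field_simps)
    qed
  qed simp
  have sums: "(\<lambda>j. real (a j) / real m ^ (j + 1)) sums x"
    using lim by (simp add: sums_def partial[simplified])
  have no_tail: "\<not> (\<exists>N. \<forall>j\<ge>N. a j = m - 1)"
  proof
    assume "\<exists>N. \<forall>j\<ge>N. a j = m - 1"
    then obtain N where "\<forall>j\<ge>N. a j = m - 1" by blast
    then have N: "a (i + N) = m - 1" for i by simp
    have "(\<lambda>i. real (a (i + N)) / real m ^ (i + N + 1)) sums (x - real_of_int (f N) / real m ^ N)"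
      using sums_split_initial_segment[OF sums, of N] partial[of N] by simp
    note scaled = sums_mult[OF this, of "real m ^ N"]
    have eq1: "real m ^ N * (c / real m ^ (i + N + 1)) = c / real m ^ (i + 1)" for c i
      using m by (simp add: power_add)
    have eq2: "real m ^ N * (x - c / real m ^ N) = real m ^ N * x - c" for c
      using m by (simp add: right_diff_distrib)
    from scaled have "(\<lambda>i. real (m - 1) / real m ^ (i + 1)) sums (real m ^ N * x - real_of_int (f N))"
      unfolding N eq1 eq2 .
    then have "real m ^ N * x - real_of_int (f N) = 1"
      using sums_top_digits[OF m] sums_unique2 by blast
    then show False using f(2)[of N] by simp
  qed
  have "a n < m" for n using nonneg[of n] less[of n] unfolding a_def by linarith
  with sums no_tail show "\<exists>a. is_base_expansion m x a"
    unfolding is_base_expansion_def by blast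
next
  fix a b assume "is_base_expansion m x a" "is_base_expansion m x b"
  then have "int (a n) = int (b n)" for n using base_expansion_floor[OF m] by metis
  then show "a = b" by auto
qed

lemma digit_expansion:
  assumes "m > 1" "x \<in> {0..<1}"
  shows "is_base_expansion m x (digit m x)"
  unfolding digit_def by (rule theI'[OF ex1_base_expansion[OF assms]])

section \<open>Digit blocks along several times\<close>

text \<open>The words \<open>(\<alpha>\<^sub>1, \<dots>, \<alpha>\<^sub>l)\<close> are lists, so \<open>\<alpha>\<^sub>i\<close> is \<open>\<alpha> ! (i - 1)\<close>; the time functions
  \<open>t 1, \<dots>, t l\<close> are indexed from 1.\<close>

definition words :: "nat \<Rightarrow> nat \<Rightarrow> nat list set" where
  "words m l = {\<alpha>. length \<alpha> = l \<and> set \<alpha> \<subseteq> {..<m}}"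

definition admissible_times :: "nat \<Rightarrow> (nat \<Rightarrow> nat \<Rightarrow> nat) \<Rightarrow> bool" where
  "admissible_times l t \<longleftrightarrow>
     (\<forall>i\<in>{1..l}. \<forall>n\<ge>1. 0 < t i n) \<and>
     (\<forall>i\<in>{2..l}. \<forall>n\<ge>1. t (i - 1) n < t i n) \<and>
     (\<exists>\<epsilon>::real. 0 < \<epsilon> \<and> \<epsilon> \<le> 1 \<and>
        (\<forall>n\<ge>1.
           (\<forall>i\<in>{2..l}. real (t i n) \<ge> real (t (i - 1) n) + \<epsilon> * real n) \<and>
           (\<forall>i\<in>{1..l}. real (t i (n + 1)) \<ge> real (t i n) + \<epsilon>)))"

definition transition_count ::
    "nat \<Rightarrow> nat \<Rightarrow> (nat \<Rightarrow> nat \<Rightarrow> nat) \<Rightarrow> nat list \<Rightarrow> nat list \<Rightarrow> real \<Rightarrow> nat \<Rightarrow> nat" where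
  "transition_count m l t \<alpha> \<beta> x n =
     card {k. 0 < k \<and> k \<le> n \<and>
              map (\<lambda>i. digit m x (t i k)) [1..<l + 1] = \<alpha> \<and>
              map (\<lambda>i. digit m x (t i k + 1)) [1..<l + 1] = \<beta>}"

definition frequency_set ::
    "nat \<Rightarrow> nat \<Rightarrow> (nat \<Rightarrow> nat \<Rightarrow> nat) \<Rightarrow> (nat list \<Rightarrow> nat list \<Rightarrow> real) \<Rightarrow> real set" where
  "frequency_set m l t P =
     {x \<in> {0<..<1}. \<forall>\<alpha>\<in>words m l. \<forall>\<beta>\<in>words m l.
        (\<lambda>n. (1 / real n) * real (transition_count m l t \<alpha> \<beta> x n)) \<longlonglongrightarrow> P \<alpha> \<beta>}"

section \<open>Nonnegative and probability matrices\<close>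

definition nonneg_matrix :: "real mat \<Rightarrow> bool" where
  "nonneg_matrix A \<longleftrightarrow> (\<forall>i<dim_row A. \<forall>j<dim_col A. 0 \<le> A $$ (i, j))"

definition pos_matrix :: "real mat \<Rightarrow> bool" where
  "pos_matrix A \<longleftrightarrow> (\<forall>i<dim_row A. \<forall>j<dim_col A. 0 < A $$ (i, j))"

definition prob_matrix :: "real mat \<Rightarrow> bool" where
  "prob_matrix A \<longleftrightarrow>
     nonneg_matrix A \<and> (\<forall>i<dim_row A. (\<Sum>j<dim_col A. A $$ (i, j)) = 1)"

definition irreducible_matrix :: "real mat \<Rightarrow> bool" where
  "irreducible_matrix A \<longleftrightarrow>
     (\<forall>i<dim_row A. \<forall>j<dim_row A. \<exists>n>0. 0 < (A ^\<^sub>m n) $$ (i, j))"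

definition aperiodic_matrix :: "real mat \<Rightarrow> bool" where
  "aperiodic_matrix A \<longleftrightarrow>
     (\<forall>i<dim_row A. Gcd {n. 0 < n \<and> 0 < (A ^\<^sub>m n) $$ (i, i)} = 1)"

definition prob_vector :: "real Matrix.vec \<Rightarrow> bool" where
  "prob_vector v \<longleftrightarrow>
     (\<forall>i<dim_vec v. 0 \<le> vec_index v i) \<and> (\<Sum>i<dim_vec v. vec_index v i) = 1"

definition pos_vector :: "real Matrix.vec \<Rightarrow> bool" where
  "pos_vector v \<longleftrightarrow> (\<forall>i<dim_vec v. 0 < vec_index v i)"

text \<open>A row vector \<open>v\<close> satisfies \<open>v A = v\<close> iff the transpose of \<open>A\<close> fixes the column vector \<open>v\<close>.\<close>

definition stationary_vector :: "real mat \<Rightarrow> real Matrix.vec \<Rightarrow> bool" where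
  "stationary_vector A v \<longleftrightarrow>
     v \<in> carrier_vec (dim_row A) \<and> prob_vector v \<and> transpose_mat A *\<^sub>v v = v"

definition row_sums :: "real mat \<Rightarrow> real Matrix.vec" where
  "row_sums R = Matrix.vec (dim_row R) (\<lambda>i. \<Sum>j<dim_col R. R $$ (i, j))"

definition normalized_rows :: "real mat \<Rightarrow> real mat" where
  "normalized_rows R =
     Matrix.mat (dim_row R) (dim_col R) (\<lambda>(i, j). R $$ (i, j) / vec_index (row_sums R) i)"

end

theory Submission
  imports Defs "HOL-Real_Asymp.Real_Asymp"
begin

text \<open>A point of \<open>U\<^sub>P\<close> is encoded by its digit sequence. A Markov measure on digit sequences gives the
  word \<open>w\<close> the weight \<open>mu w = q w\<^sub>0 * (\<Prod>i. Q w\<^sub>i w\<^sub>i\<^sub>+\<^sub>1)\<close>, and since \<open>q\<^sub>1(k) = k\<close> the frequencies prescribed by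
  \<open>P\<close> determine the frequencies \<open>r\<^sub>i\<^sub>j\<close> of two-letter words. Hence, zero entries of \<open>Q\<close> aside, along every sequence in \<open>U\<^sub>P\<close>
  the weight of the first \<open>n\<close> letters is \<open>exp (- n h + o(n))\<close>, \<open>h\<close> the entropy, while the corresponding interval has length
  \<open>m\<^sup>-\<^sup>n\<close>; comparing the two gives both bounds \<open>h / ln m\<close>, provided \<open>U\<^sub>P\<close> is not null for the outer measure
  generated by the weights \<open>mu w\<close>. For this, the chain forgets its past at an exponential rate, so blocks
  read at times that do not nearly coincide are almost uncorrelated. The growth conditions on the times
  \<open>q\<^sub>i\<close> leave only \<open>O(n d)\<close> pairs of blocks closer than \<open>d\<close>, so the variance bound, the Borel-Cantelli lemma along
  cubes and monotonicity of the counts show that almost every sequence has the prescribed frequencies.\<close>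

section \<open>Markov weights on words\<close>

text \<open>No measure on the sequence space is constructed: probabilities are finite sums over
  words of a fixed length. The times after the first may grow arbitrarily fast, so the estimates
  must not depend on the word length at which an expectation is evaluated. Cubes come from the
  choice of the separation: for \<open>n = j^3\<close> and a separation proportional to
  \<open>j\<close>, nearby pairs contribute \<open>O(n j)\<close> to the variance, hence
  \<open>O(1/j^2)\<close> after division by \<open>n^2\<close>, while all other pairs contribute a
  term exponentially small in \<open>j\<close>; both are summable. The two dimension bounds use
  opposite one-sided estimates of word weights. A transition of probability zero has limiting
  frequency zero but may still occur, and then \<open>mu\<close> of all longer prefixes vanishes.
  This is harmless where \<open>mu\<close> is bounded from above; where a lower bound is needed, a
  chain with positive entries takes its place. Sequences with a constant tail, which the digit map
  may miss, are excluded because no pair \<open>(c, c)\<close> has frequency 1.\<close>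

lemma finite_words: "finite (words m n)"
  using finite_lists_length_eq[of "{..<m}" n] by (simp add: words_def conj_commute)

lemma words_0 [simp]: "words m 0 = {[]}"
  by (auto simp: words_def)

lemma sum_words_snoc:
  "(\<Sum>w\<in>words m (Suc n). f w) = (\<Sum>w\<in>words m n. \<Sum>c<m. f (w @ [c]))"
proof -
  have "(\<Sum>w\<in>words m (Suc n). f w) = (\<Sum>(w, c)\<in>words m n \<times> {..<m}. f (w @ [c]))"
  proof (rule sum.reindex_bij_witness[of _ "\<lambda>(w, c). w @ [c]" "\<lambda>w. (butlast w, last w)"])
    fix w assume "w \<in> words m (Suc n)"
    then have w: "w \<noteq> []" "length w = Suc n" "set w \<subseteq> {..<m}" by (auto simp: words_def)
    from w show "(case (butlast w, last w) of (w, c) \<Rightarrow> w @ [c]) = w" by simp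
    from w show "(butlast w, last w) \<in> words m n \<times> {..<m}"
      using in_set_butlastD last_in_set[of w] by (fastforce simp: words_def)
    from w show "(case (butlast w, last w) of (w, c) \<Rightarrow> f (w @ [c])) = f w" by simp
  qed (auto simp: words_def)
  then show ?thesis by (simp add: sum.cartesian_product)
qed

lemma sum_words_Cons:
  "(\<Sum>w\<in>words m (Suc n). f w) = (\<Sum>c<m. \<Sum>w\<in>words m n. f (c # w))"
proof -
  have "(\<Sum>w\<in>words m (Suc n). f w) = (\<Sum>(c, w)\<in>{..<m} \<times> words m n. f (c # w))"
    by (rule sum.reindex_bij_witness[of _ "\<lambda>(c, w). c # w" "\<lambda>w. (hd w, tl w)"])
      (auto simp: words_def length_Suc_conv)
  then show ?thesis by (simp add: sum.cartesian_product)
qed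

text \<open>A product over coordinates can be summed one coordinate at a time. This is what allows
  all coordinates of \<open>P\<close> but the first to be summed out.\<close>

lemma sum_words_prod:
  fixes f :: "nat \<Rightarrow> nat \<Rightarrow> nat \<Rightarrow> real"
  shows "(\<Sum>\<alpha>\<in>words m n. \<Sum>\<beta>\<in>words m n. \<Prod>i<n. f i (\<alpha> ! i) (\<beta> ! i)) =
         (\<Prod>i<n. \<Sum>a<m. \<Sum>b<m. f i a b)"
proof (induction n arbitrary: f)
  case (Suc n)
  have "(\<Sum>\<alpha>\<in>words m (Suc n). \<Sum>\<beta>\<in>words m (Suc n). \<Prod>i<Suc n. f i (\<alpha> ! i) (\<beta> ! i)) =
    (\<Sum>a<m. \<Sum>\<alpha>\<in>words m n. \<Sum>b<m. \<Sum>\<beta>\<in>words m n. f 0 a b * (\<Prod>i<n. f (Suc i) (\<alpha> ! i) (\<beta> ! i)))"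
    by (simp add: sum_words_Cons prod.lessThan_Suc_shift del: prod.lessThan_Suc)
  also have "\<dots> = (\<Sum>a<m. \<Sum>b<m. f 0 a b * (\<Sum>\<alpha>\<in>words m n. \<Sum>\<beta>\<in>words m n. \<Prod>i<n. f (Suc i) (\<alpha> ! i) (\<beta> ! i)))"
    by (subst sum.swap[of _ "{..<m}" "words m n"]) (simp add: sum_distrib_left)
  also have "\<dots> = (\<Prod>i<Suc n. \<Sum>a<m. \<Sum>b<m. f i a b)"
    by (simp add: Suc.IH[of "\<lambda>i. f (Suc i)"] sum_distrib_right prod.lessThan_Suc_shift del: prod.lessThan_Suc)
  finally show ?case .
qed simp

section \<open>Expectations of functions of finitely many letters\<close>

text \<open>Observables are functions of infinite sequences, so that the same one can be evaluated
  on words of every length through \<open>(!) w\<close>. Entries of \<open>w\<close> beyond its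
  length are junk; this predicate guarantees that they are not consulted.\<close>

definition depends_on_prefix :: "nat \<Rightarrow> ((nat \<Rightarrow> nat) \<Rightarrow> 'a) \<Rightarrow> bool" where
  "depends_on_prefix n \<Phi> \<longleftrightarrow> (\<forall>a b. (\<forall>i<n. a i = b i) \<longrightarrow> \<Phi> a = \<Phi> b)"

lemma depends_on_prefixD:
  "depends_on_prefix n \<Phi> \<Longrightarrow> (\<And>i. i < n \<Longrightarrow> a i = b i) \<Longrightarrow> \<Phi> a = \<Phi> b"
  by (auto simp: depends_on_prefix_def)

lemma depends_on_prefix_mono:
  "depends_on_prefix n \<Phi> \<Longrightarrow> n \<le> n' \<Longrightarrow> depends_on_prefix n' \<Phi>"
  by (auto simp: depends_on_prefix_def)

locale markov_weights =
  fixes m :: nat and q :: "nat \<Rightarrow> real" and Q :: "nat \<Rightarrow> nat \<Rightarrow> real"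
  assumes q_nonneg: "i < m \<Longrightarrow> 0 \<le> q i"
    and q_sum: "(\<Sum>i<m. q i) = 1"
    and Q_nonneg: "i < m \<Longrightarrow> j < m \<Longrightarrow> 0 \<le> Q i j"
    and Q_sum: "i < m \<Longrightarrow> (\<Sum>j<m. Q i j) = 1"
begin

text \<open>Weight 1 for the empty word makes the weights of the children add up to that of the
  parent at the root as well.\<close>

definition mu :: "nat list \<Rightarrow> real" where
  "mu w = (if w = [] then 1 else q (hd w) * (\<Prod>i<length w - 1. Q (w ! i) (w ! Suc i)))"

lemma mu_Nil [simp]: "mu [] = 1"
  by (simp add: mu_def)

lemma mu_nonneg:
  assumes "w \<in> words m n" shows "0 \<le> mu w"
proof -
  have w: "w ! i < m" if "i < length w" for i
    using that assms nth_mem[of i w] by (auto simp: words_def subset_iff)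
  then show ?thesis
    by (auto simp: mu_def hd_conv_nth intro!: mult_nonneg_nonneg prod_nonneg q_nonneg Q_nonneg)
qed

lemma mu_snoc:
  assumes "w \<noteq> []" shows "mu (w @ [c]) = mu w * Q (last w) c"
proof -
  obtain n where n: "length w = Suc n" using assms by (cases w) auto
  have "(\<Prod>i<n. Q ((w @ [c]) ! i) ((w @ [c]) ! Suc i)) = (\<Prod>i<n. Q (w ! i) (w ! Suc i))"
    using n by (intro prod.cong) (auto simp: nth_append)
  then show ?thesis using assms n
    by (simp add: mu_def nth_append last_conv_nth)
qed

lemma sum_mu_children:
  assumes "w \<in> words m n" shows "(\<Sum>c<m. mu (w @ [c])) = mu w"
proof (cases "w = []")
  case True
  then show ?thesis by (simp add: mu_def q_sum)
next
  case False
  then have "last w < m" using assms last_in_set[of w] by (auto simp: words_def subset_iff)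
  then show ?thesis using False by (simp add: mu_snoc Q_sum flip: sum_distrib_left)
qed

lemma mu_map:
  "mu (map a [0..<Suc n]) = q (a 0) * (\<Prod>i<n. Q (a i) (a (Suc i)))"
proof -
  have "(\<Prod>i<n. Q (map a [0..<Suc n] ! i) (map a [0..<Suc n] ! Suc i)) = (\<Prod>i<n. Q (a i) (a (Suc i)))"
    by (intro prod.cong) (auto simp del: upt_Suc)
  then show ?thesis by (simp add: mu_def hd_map del: upt_Suc)
qed

text \<open>The transition from position 0 to position 1 is split off because transition counts
  start at time 1.\<close>

lemma mu_Suc_Suc:
  "mu (map a [0..<Suc (Suc n)]) = q (a 0) * Q (a 0) (a 1) * (\<Prod>k=1..n. Q (a k) (a (Suc k)))"
  unfolding mu_map
  by (simp add: prod.lessThan_Suc_shift prod.atLeast1_atMost_eq mult.assoc del: prod.lessThan_Suc)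

definition expect :: "nat \<Rightarrow> ((nat \<Rightarrow> nat) \<Rightarrow> real) \<Rightarrow> real" where
  "expect n \<Phi> = (\<Sum>w\<in>words m n. mu w * \<Phi> ((!) w))"

lemma expect_mono:
  assumes "\<And>w. w \<in> words m n \<Longrightarrow> \<Phi> ((!) w) \<le> \<Psi> ((!) w)"
  shows "expect n \<Phi> \<le> expect n \<Psi>"
  unfolding expect_def using assms mu_nonneg by (intro sum_mono mult_left_mono) auto

lemma expect_sum: "expect n (\<lambda>a. \<Sum>i\<in>I. \<Phi> i a) = (\<Sum>i\<in>I. expect n (\<Phi> i))"
  unfolding expect_def by (simp add: sum_distrib_left sum.swap[of _ I])

lemma expect_add: "expect n (\<lambda>a. \<Phi> a + \<Psi> a) = expect n \<Phi> + expect n \<Psi>"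
  unfolding expect_def by (simp add: sum.distrib ring_distribs)

lemma expect_diff: "expect n (\<lambda>a. \<Phi> a - \<Psi> a) = expect n \<Phi> - expect n \<Psi>"
  unfolding expect_def by (simp add: sum_subtractf ring_distribs)

lemma expect_mult_right: "expect n (\<lambda>a. \<Phi> a * c) = expect n \<Phi> * c"
  unfolding expect_def by (simp add: sum_distrib_right mult.assoc)

lemma sum_mu: "(\<Sum>w\<in>words m n. mu w) = 1"
proof (induction n)
  case (Suc n)
  then show ?case by (simp add: sum_words_snoc sum_mu_children)
qed simp

lemma expect_const [simp]: "expect n (\<lambda>a. c) = c"
  unfolding expect_def by (simp add: sum_mu flip: sum_distrib_right)

lemma expect_abs: "\<bar>expect n \<Phi>\<bar> \<le> expect n (\<lambda>a. \<bar>\<Phi> a\<bar>)"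
  unfolding expect_def by (rule order_trans[OF sum_abs]) (auto simp: abs_mult mu_nonneg intro!: sum_mono)

lemma expect_bound:
  assumes "\<And>w. w \<in> words m n \<Longrightarrow> \<bar>\<Phi> ((!) w)\<bar> \<le> B"
  shows "\<bar>expect n \<Phi>\<bar> \<le> B"
  using expect_abs[of n \<Phi>] expect_mono[of n "\<lambda>a. \<bar>\<Phi> a\<bar>" "\<lambda>_. B"] assms by simp

lemma chebyshev:
  assumes "e > 0"
  shows "(\<Sum>w\<in>{w\<in>words m N. e \<le> \<bar>\<Phi> ((!) w)\<bar>}. mu w) \<le> expect N (\<lambda>a. (\<Phi> a)\<^sup>2) / e\<^sup>2"
proof -
  have "(\<Sum>w\<in>{w\<in>words m N. e \<le> \<bar>\<Phi> ((!) w)\<bar>}. mu w) * e\<^sup>2 =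
      (\<Sum>w\<in>{w\<in>words m N. e \<le> \<bar>\<Phi> ((!) w)\<bar>}. mu w * e\<^sup>2)" by (rule sum_distrib_right)
  also have "\<dots> \<le> (\<Sum>w\<in>{w\<in>words m N. e \<le> \<bar>\<Phi> ((!) w)\<bar>}. mu w * (\<Phi> ((!) w))\<^sup>2)"
  proof (intro sum_mono mult_left_mono)
    fix w assume w: "w \<in> {w\<in>words m N. e \<le> \<bar>\<Phi> ((!) w)\<bar>}"
    then show "0 \<le> mu w" using mu_nonneg by blast
    from w show "e\<^sup>2 \<le> (\<Phi> ((!) w))\<^sup>2" using \<open>e > 0\<close> by (simp add: abs_le_square_iff[symmetric])
  qed
  also have "\<dots> \<le> expect N (\<lambda>a. (\<Phi> a)\<^sup>2)"
    unfolding expect_def using mu_nonneg by (intro sum_mono2 finite_words) auto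
  finally show ?thesis using \<open>e > 0\<close> by (simp add: field_simps)
qed

text \<open>Consistency of the finite-level laws: a further letter only distributes the weight of a
  word among its children.\<close>

lemma expect_prefix:
  assumes "depends_on_prefix n \<Phi>" "n \<le> n'"
  shows "expect n' \<Phi> = expect n \<Phi>"
  using assms(2)
proof (induction n' rule: dec_induct)
  case (step k)
  have "expect (Suc k) \<Phi> = (\<Sum>w\<in>words m k. \<Sum>c<m. mu (w @ [c]) * \<Phi> ((!) w))"
    unfolding expect_def sum_words_snoc
  proof (intro sum.cong refl)
    fix w c assume "w \<in> words m k"
    then have "length w = k" by (simp add: words_def)
    then have "\<Phi> ((!) (w @ [c])) = \<Phi> ((!) w)"
      using step.hyps(1) by (intro depends_on_prefixD[OF assms(1)]) (simp add: nth_append)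
    then show "mu (w @ [c]) * \<Phi> ((!) (w @ [c])) = mu (w @ [c]) * \<Phi> ((!) w)" by simp
  qed
  also have "\<dots> = expect k \<Phi>"
    unfolding expect_def by (intro sum.cong) (simp_all add: sum_mu_children flip: sum_distrib_right)
  finally show ?case using step.IH by simp
qed simp

text \<open>The Markov property: the last letter is integrated out given its predecessor, and
  everything earlier stays untouched.\<close>

lemma expect_markov:
  assumes "depends_on_prefix (Suc n) \<Phi>"
  shows "expect (Suc (Suc n)) (\<lambda>a. \<Phi> a * g (a n) (a (Suc n))) =
         expect (Suc n) (\<lambda>a. \<Phi> a * (\<Sum>c<m. Q (a n) c * g (a n) c))"
  unfolding expect_def sum_words_snoc[where n = "Suc n"] sum_distrib_left
proof (intro sum.cong refl)
  fix w c assume "w \<in> words m (Suc n)"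
  then have w: "length w = Suc n" "w \<noteq> []" by (auto simp: words_def)
  have "\<Phi> ((!) (w @ [c])) = \<Phi> ((!) w)"
    using w by (intro depends_on_prefixD[OF assms(1)]) (simp add: nth_append)
  then show "mu (w @ [c]) * (\<Phi> ((!) (w @ [c])) * g ((w @ [c]) ! n) ((w @ [c]) ! Suc n)) =
    mu w * (\<Phi> ((!) w) * (Q (w ! n) c * g (w ! n) c))"
    using w by (simp add: nth_append mu_snoc last_conv_nth)
qed

text \<open>The transition operator: the conditional expectation of \<open>g\<close> at the next
  letter, given that the present letter is \<open>i\<close>.\<close>

definition Qop :: "(nat \<Rightarrow> real) \<Rightarrow> nat \<Rightarrow> real" where
  "Qop g i = (\<Sum>c<m. Q i c * g c)"

lemma Ex_Qop:
  assumes "depends_on_prefix (Suc s) \<Phi>"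
  shows "expect (Suc (s + d)) (\<lambda>a. \<Phi> a * g (a (s + d))) = expect (Suc s) (\<lambda>a. \<Phi> a * (Qop ^^ d) g (a s))"
proof (induction d arbitrary: g)
  case (Suc d)
  have "depends_on_prefix (Suc (s + d)) \<Phi>" using assms by (rule depends_on_prefix_mono) simp
  from expect_markov[OF this, of "\<lambda>_. g"]
  have "expect (Suc (s + Suc d)) (\<lambda>a. \<Phi> a * g (a (s + Suc d))) =
    expect (Suc (s + d)) (\<lambda>a. \<Phi> a * Qop g (a (s + d)))" by (simp add: Qop_def)
  then show ?case by (simp add: Suc.IH funpow_swap1)
qed simp

lemma Qop_diff_const:
  assumes "i < m" shows "(Qop ^^ d) (\<lambda>c. g c - x) i = (Qop ^^ d) g i - x"
  using assms
proof (induction d arbitrary: i)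
  case (Suc d)
  have "(Qop ^^ Suc d) (\<lambda>c. g c - x) i = (\<Sum>c<m. Q i c * ((Qop ^^ d) g c - x))"
    by (simp add: Qop_def[of "(Qop ^^ d) (\<lambda>c. g c - x)"] Suc.IH)
  also have "\<dots> = (Qop ^^ Suc d) g i - (\<Sum>c<m. Q i c) * x"
    by (simp add: Qop_def right_diff_distrib sum_subtractf sum_distrib_right)
  finally show ?case using Suc.prems by (simp add: Q_sum)
qed simp

end

section \<open>Exponential mixing\<close>

text \<open>\<open>K\<close> is the \<open>k\<close>-step transition kernel, given by its action on
  functions; the uniform lower bound \<delta> on its entries is a Doeblin condition.\<close>

locale mixing_chain = markov_weights +
  fixes k :: nat and K :: "nat \<Rightarrow> nat \<Rightarrow> real" and \<delta> :: real
  assumes stationary: "j < m \<Longrightarrow> (\<Sum>i<m. q i * Q i j) = q j"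
    and k_pos: "k > 0"
    and K_kernel: "i < m \<Longrightarrow> (Qop ^^ k) g i = (\<Sum>j<m. K i j * g j)"
    and \<delta>_pos: "0 < \<delta>"
    and K_ge: "i < m \<Longrightarrow> j < m \<Longrightarrow> \<delta> \<le> K i j"
begin

lemma q_le_1: "i < m \<Longrightarrow> q i \<le> 1"
  using member_le_sum[of i "{..<m}" q] q_nonneg q_sum by auto

lemma mean_Qop: "(\<Sum>i<m. q i * (Qop ^^ d) g i) = (\<Sum>i<m. q i * g i)"
proof (induction d)
  case (Suc d)
  have "(\<Sum>i<m. q i * (Qop ^^ Suc d) g i) = (\<Sum>i<m. \<Sum>c<m. q i * Q i c * (Qop ^^ d) g c)"
    by (simp add: Qop_def sum_distrib_left mult.assoc)
  also have "\<dots> = (\<Sum>c<m. (\<Sum>i<m. q i * Q i c) * (Qop ^^ d) g c)"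
    by (subst sum.swap) (simp add: sum_distrib_right)
  finally show ?case using Suc.IH by (simp add: stationary)
qed simp

lemma K_sum: "i < m \<Longrightarrow> (\<Sum>j<m. K i j) = 1"
  \<comment> \<open>The constant function 1 is written as \<open>0 - (-1)\<close>, so that the
    recentring lemma computes its image.\<close>
  using K_kernel[of i "\<lambda>_. 1"] Qop_diff_const[of i k "\<lambda>_. 0" "-1"] K_kernel[of i "\<lambda>_. 0"] by simp

lemma \<delta>_le_1: "\<delta> \<le> 1"
proof -
  obtain i where i: "i < m" using q_sum by (cases m) auto
  have "\<delta> \<le> K i i" using K_ge i by simp
  also have "\<dots> \<le> (\<Sum>j<m. K i j)"
    using i K_ge \<delta>_pos by (intro member_le_sum) (auto intro: order_trans[of 0 \<delta>])
  finally show ?thesis using K_sum[OF i] by simp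
qed

text \<open>Doeblin's argument: subtracting \<open>\<delta> q j\<close> from every entry of the kernel does not change its
  action on functions of mean zero and leaves nonnegative rows of total mass \<open>1 - \<delta>\<close>.\<close>

lemma Qop_contract:
  assumes i: "i < m" and B: "\<And>j. j < m \<Longrightarrow> \<bar>v j\<bar> \<le> B" and mean: "(\<Sum>j<m. q j * v j) = 0"
  shows "\<bar>(Qop ^^ k) v i\<bar> \<le> (1 - \<delta>) * B"
proof -
  have ge: "\<delta> * q j \<le> K i j" if "j < m" for j
    using mult_left_le[OF q_le_1[OF that] less_imp_le[OF \<delta>_pos]] K_ge[OF i that] by simp
  have "(Qop ^^ k) v i = (\<Sum>j<m. (K i j - \<delta> * q j) * v j)"
    using mean i
    by (simp add: K_kernel left_diff_distrib sum_subtractf mult.assoc flip: sum_distrib_left)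
  also have "\<bar>\<dots>\<bar> \<le> (\<Sum>j<m. (K i j - \<delta> * q j) * B)"
    using ge B by (intro order_trans[OF sum_abs] sum_mono)
      (auto simp: abs_mult intro!: mult_mono)
  also have "\<dots> = (1 - \<delta>) * B"
    using i by (simp add: K_sum q_sum sum_subtractf flip: sum_distrib_right sum_distrib_left)
  finally show ?thesis .
qed

text \<open>Stationarity keeps the mean at zero under every power of the operator, so the one-step
  contraction can be iterated.\<close>

lemma Qop_decay:
  assumes "\<And>j. j < m \<Longrightarrow> \<bar>v j\<bar> \<le> B" "(\<Sum>j<m. q j * v j) = 0" "i < m"
  shows "\<bar>(Qop ^^ (k * n)) v i\<bar> \<le> (1 - \<delta>) ^ n * B"
  using assms(3)
proof (induction n arbitrary: i)
  case (Suc n)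
  have "\<bar>(Qop ^^ k) ((Qop ^^ (k * n)) v) i\<bar> \<le> (1 - \<delta>) * ((1 - \<delta>) ^ n * B)"
    using Suc assms(2) by (intro Qop_contract) (auto simp: mean_Qop)
  then show ?case by (simp add: funpow_add)
qed (use assms in auto)

definition pair_mean :: "(nat \<Rightarrow> nat \<Rightarrow> real) \<Rightarrow> real" where
  "pair_mean \<phi> = (\<Sum>i<m. \<Sum>j<m. q i * Q i j * \<phi> i j)"

lemma pair_mean_bounds:
  assumes "\<And>i j. 0 \<le> \<phi> i j \<and> \<phi> i j \<le> 1"
  shows "0 \<le> pair_mean \<phi>" "pair_mean \<phi> \<le> 1"
proof -
  show "0 \<le> pair_mean \<phi>"
    unfolding pair_mean_def using assms by (intro sum_nonneg mult_nonneg_nonneg q_nonneg Q_nonneg) auto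
  have "pair_mean \<phi> \<le> (\<Sum>i<m. \<Sum>j<m. q i * Q i j * 1)"
    unfolding pair_mean_def using assms by (intro sum_mono mult_left_mono mult_nonneg_nonneg q_nonneg Q_nonneg) auto
  also have "\<dots> = 1" by (simp add: Q_sum q_sum flip: sum_distrib_left)
  finally show "pair_mean \<phi> \<le> 1" .
qed

text \<open>Given the letters up to position \<open>s\<close>, the conditional mean of the pair at
  position \<open>u\<close> is a power of the operator applied to the one-step mean
  \<open>g\<close>. After \<open>n\<close> rounds of \<open>k\<close> steps it differs from the
  stationary mean by at most \<open>(1 - \<delta>) ^ n\<close>, whatever the letter at
  \<open>s\<close> is.\<close>

lemma expect_decorrelate:
  assumes dep: "depends_on_prefix (Suc s) \<Phi>" and \<Phi>: "\<And>a. \<bar>\<Phi> a\<bar> \<le> 1"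
    and \<phi>: "\<And>i j. 0 \<le> \<phi> i j \<and> \<phi> i j \<le> 1" and u: "u = s + k * n"
  shows "\<bar>expect (Suc (Suc u)) (\<lambda>a. \<Phi> a * \<phi> (a u) (a (Suc u))) - expect (Suc s) \<Phi> * pair_mean \<phi>\<bar> \<le> (1 - \<delta>) ^ n"
proof -
  define g where "g i = (\<Sum>c<m. Q i c * \<phi> i c)" for i
  have g: "0 \<le> g i \<and> g i \<le> 1" if "i < m" for i
  proof
    show "0 \<le> g i" unfolding g_def using that \<phi> by (intro sum_nonneg mult_nonneg_nonneg Q_nonneg) auto
    have "g i \<le> (\<Sum>c<m. Q i c * 1)"
      unfolding g_def using that \<phi> by (intro sum_mono mult_left_mono Q_nonneg) auto
    then show "g i \<le> 1" using that by (simp add: Q_sum)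
  qed
  have mean: "(\<Sum>i<m. q i * g i) = pair_mean \<phi>"
    by (simp add: g_def pair_mean_def sum_distrib_left mult.assoc)
  have decay: "\<bar>(Qop ^^ (k * n)) g i - pair_mean \<phi>\<bar> \<le> (1 - \<delta>) ^ n" if "i < m" for i
  proof -
    have "\<bar>g j - pair_mean \<phi>\<bar> \<le> 1" if "j < m" for j
      using g[OF that] pair_mean_bounds[of \<phi>] \<phi> by (auto simp: abs_le_iff)
    moreover have "(\<Sum>j<m. q j * (g j - pair_mean \<phi>)) = 0"
      by (simp add: right_diff_distrib sum_subtractf mean q_sum flip: sum_distrib_right)
    ultimately show ?thesis
      using Qop_decay[of "\<lambda>j. g j - pair_mean \<phi>" 1 i n] that by (simp add: Qop_diff_const)
  qed
  have "depends_on_prefix (Suc u) \<Phi>" using dep by (rule depends_on_prefix_mono) (simp add: u)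
  then have "expect (Suc (Suc u)) (\<lambda>a. \<Phi> a * \<phi> (a u) (a (Suc u))) = expect (Suc u) (\<lambda>a. \<Phi> a * g (a u))"
    unfolding g_def by (rule expect_markov)
  also have "\<dots> = expect (Suc s) (\<lambda>a. \<Phi> a * (Qop ^^ (k * n)) g (a s))"
    unfolding u by (rule Ex_Qop[OF dep])
  finally have "expect (Suc (Suc u)) (\<lambda>a. \<Phi> a * \<phi> (a u) (a (Suc u))) - expect (Suc s) \<Phi> * pair_mean \<phi> =
    expect (Suc s) (\<lambda>a. \<Phi> a * ((Qop ^^ (k * n)) g (a s) - pair_mean \<phi>))"
    by (simp add: right_diff_distrib expect_diff expect_mult_right)
  also have "\<bar>\<dots>\<bar> \<le> (1 - \<delta>) ^ n"
  proof (rule expect_bound)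
    fix w assume "w \<in> words m (Suc s)"
    then have "w ! s < m" using nth_mem[of s w] by (auto simp: words_def subset_iff)
    from mult_mono[OF \<Phi> decay[OF this]]
    show "\<bar>\<Phi> ((!) w) * ((Qop ^^ (k * n)) g (w ! s) - pair_mean \<phi>)\<bar> \<le> (1 - \<delta>) ^ n"
      by (simp add: abs_mult)
  qed
  finally show ?thesis .
qed

text \<open>Factors enter in the order of their positions, so the new one is always the last and can
  be replaced by its mean at the cost \<open>(1 - \<delta>) ^ n\<close>. Means lie in
  \<open>[0, 1]\<close>, hence earlier errors are not amplified. The condition
  \<open>d \<le> p i\<close> makes room for the separation in front of the earliest factor
  too.\<close>

lemma expect_prod:
  assumes "finite I" "d = k * n" "n > 0"
    and \<phi>: "\<And>i x y. 0 \<le> \<phi> i x y \<and> \<phi> i x y \<le> 1"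
    and "\<And>i. i \<in> I \<Longrightarrow> d \<le> p i"
    and "\<And>i j. i \<in> I \<Longrightarrow> j \<in> I \<Longrightarrow> i \<noteq> j \<Longrightarrow> p i + d < p j \<or> p j + d < p i"
    and "\<And>i. i \<in> I \<Longrightarrow> Suc (Suc (p i)) \<le> N"
  shows "\<bar>expect N (\<lambda>a. \<Prod>i\<in>I. \<phi> i (a (p i)) (a (Suc (p i)))) - (\<Prod>i\<in>I. pair_mean (\<phi> i))\<bar>
           \<le> card I * (1 - \<delta>) ^ n"
  using assms(1,5-7)
proof (induction I arbitrary: N rule: finite_ranking_induct[where f = p])
  case (insert u I)
  show ?case
  proof (cases "u \<in> I")
    case True
    with insert show ?thesis by (simp add: insert_absorb)
  next
    case False
    define s where "s = p u - d"
    define \<Phi> where "\<Phi> a = (\<Prod>i\<in>I. \<phi> i (a (p i)) (a (Suc (p i))))" for a :: "nat \<Rightarrow> nat"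
    have "d > 0" using assms(2,3) k_pos by simp
    \<comment> \<open>Strictness gives \<open>p i < s\<close>, so the second letter of an earlier
      pair, at \<open>Suc (p i)\<close>, still lies at or before \<open>s\<close>.\<close>
    have gap: "p i + d < p u" if "i \<in> I" for i
      using insert.prems(2)[of i u] insert.hyps(2)[OF that] that False by force
    have u: "p u = s + k * n" using insert.prems(1)[of u] by (simp add: s_def assms(2))
    have dep: "depends_on_prefix (Suc s) \<Phi>"
      unfolding depends_on_prefix_def \<Phi>_def
    proof (intro allI impI prod.cong refl)
      fix a b :: "nat \<Rightarrow> nat" and i assume ab: "\<forall>i<Suc s. a i = b i" and "i \<in> I"
      from gap[OF this(2)] have "p i < Suc s" "Suc (p i) < Suc s" by (auto simp: s_def)
      with ab show "\<phi> i (a (p i)) (a (Suc (p i))) = \<phi> i (b (p i)) (b (Suc (p i)))" by metis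
    qed
    have \<Phi>: "0 \<le> \<Phi> a \<and> \<Phi> a \<le> 1" for a
      unfolding \<Phi>_def using \<phi> by (auto intro!: prod_nonneg prod_le_1)
    have "depends_on_prefix (Suc (Suc (p u))) (\<lambda>a. \<Phi> a * \<phi> u (a (p u)) (a (Suc (p u))))"
      unfolding depends_on_prefix_def
    proof (intro allI impI)
      fix a b :: "nat \<Rightarrow> nat" assume ab: "\<forall>i<Suc (Suc (p u)). a i = b i"
      then have "\<Phi> a = \<Phi> b" using u by (intro depends_on_prefixD[OF dep]) auto
      with ab show "\<Phi> a * \<phi> u (a (p u)) (a (Suc (p u))) = \<Phi> b * \<phi> u (b (p u)) (b (Suc (p u)))" by simp
    qed
    then have "expect N (\<lambda>a. \<Phi> a * \<phi> u (a (p u)) (a (Suc (p u)))) =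
        expect (Suc (Suc (p u))) (\<lambda>a. \<Phi> a * \<phi> u (a (p u)) (a (Suc (p u))))"
      by (rule expect_prefix) (use insert.prems(3) in auto)
    moreover have "\<bar>expect (Suc (Suc (p u))) (\<lambda>a. \<Phi> a * \<phi> u (a (p u)) (a (Suc (p u)))) -
        expect (Suc s) \<Phi> * pair_mean (\<phi> u)\<bar> \<le> (1 - \<delta>) ^ n"
      using \<Phi> \<phi> by (intro expect_decorrelate[OF dep _ _ u]) auto
    moreover have "\<bar>expect (Suc s) \<Phi> - (\<Prod>i\<in>I. pair_mean (\<phi> i))\<bar> \<le> card I * (1 - \<delta>) ^ n"
      unfolding \<Phi>_def
    proof (rule insert.IH)
      show "Suc (Suc (p i)) \<le> Suc s" if "i \<in> I" for i using gap[OF that] by (auto simp: s_def)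
    qed (use insert.prems in auto)
    moreover have "\<bar>expect (Suc s) \<Phi> * pair_mean (\<phi> u) - (\<Prod>i\<in>I. pair_mean (\<phi> i)) * pair_mean (\<phi> u)\<bar>
        \<le> \<bar>expect (Suc s) \<Phi> - (\<Prod>i\<in>I. pair_mean (\<phi> i))\<bar>"
      using pair_mean_bounds[of "\<phi> u"] \<phi>
      by (auto simp: abs_mult mult_left_le simp flip: left_diff_distrib)
    ultimately have "\<bar>expect N (\<lambda>a. \<Phi> a * \<phi> u (a (p u)) (a (Suc (p u)))) -
        (\<Prod>i\<in>I. pair_mean (\<phi> i)) * pair_mean (\<phi> u)\<bar> \<le> (1 - \<delta>) ^ n + card I * (1 - \<delta>) ^ n"
      by linarith
    moreover have "expect N (\<lambda>a. \<Prod>i\<in>insert u I. \<phi> i (a (p i)) (a (Suc (p i)))) =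
        expect N (\<lambda>a. \<Phi> a * \<phi> u (a (p u)) (a (Suc (p u))))"
      unfolding \<Phi>_def using insert.hyps(1) False by (simp add: mult.commute)
    ultimately show ?thesis
      using insert.hyps(1) False by (simp add: algebra_simps)
  qed
qed simp

end

section \<open>Null sets of sequences\<close>

definition letter_sequences :: "nat \<Rightarrow> (nat \<Rightarrow> nat) set" where
  "letter_sequences m = {a. \<forall>i. a i < m}"

lemma map_in_words: "a \<in> letter_sequences m \<Longrightarrow> map a [0..<n] \<in> words m n"
  by (auto simp: letter_sequences_def words_def)

context markov_weights
begin

text \<open>A measure on the set of words, not on sequences: \<open>emeasure Mu W\<close> is the
  total weight of the family \<open>W\<close>, which makes countable subadditivity available for
  covers. Every word length carries total mass 1, so the whole measure is infinite.\<close>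

definition Mu :: "nat list measure" where
  "Mu = point_measure UNIV (\<lambda>w. ennreal (mu w))"

lemma emeasure_Mu_finite: "finite W \<Longrightarrow> emeasure Mu W = (\<Sum>w\<in>W. ennreal (mu w))"
  unfolding Mu_def by (simp add: emeasure_point_measure_finite2)

lemma sets_Mu [simp]: "sets Mu = UNIV"
  unfolding Mu_def by (simp add: sets_point_measure)

text \<open>The null sets of the outer measure that the cylinder weights \<open>mu\<close> induce on sequences.\<close>

definition null :: "(nat \<Rightarrow> nat) set \<Rightarrow> bool" where
  "null A \<longleftrightarrow> (\<forall>e>0. \<exists>W. (\<forall>a\<in>A. \<exists>n. map a [0..<n] \<in> W) \<and> emeasure Mu W \<le> ennreal e)"

lemma null_subset:
  assumes "null B" "A \<subseteq> B" shows "null A"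
  unfolding null_def
proof (intro allI impI)
  fix e :: real assume "e > 0"
  then obtain W where "\<forall>a\<in>B. \<exists>n. map a [0..<n] \<in> W" "emeasure Mu W \<le> ennreal e"
    using assms(1) unfolding null_def by blast
  then show "\<exists>W. (\<forall>a\<in>A. \<exists>n. map a [0..<n] \<in> W) \<and> emeasure Mu W \<le> ennreal e"
    using assms(2) by blast
qed

lemma null_UN:
  fixes A :: "nat \<Rightarrow> (nat \<Rightarrow> nat) set"
  assumes "\<And>i. null (A i)"
  shows "null (\<Union>i. A i)"
  unfolding null_def
proof (intro allI impI)
  fix e :: real assume "e > 0"
  have "\<exists>W. (\<forall>a\<in>A i. \<exists>n. map a [0..<n] \<in> W) \<and> emeasure Mu W \<le> ennreal (e * (1/2) ^ Suc i)" for i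
  proof -
    have "0 < e * (1/2) ^ Suc i" using \<open>e > 0\<close> by simp
    with assms[of i] show ?thesis unfolding null_def by (metis (no_types, lifting))
  qed
  then obtain W where W: "\<And>i. (\<forall>a\<in>A i. \<exists>n. map a [0..<n] \<in> W i) \<and> emeasure Mu (W i) \<le> ennreal (e * (1/2) ^ Suc i)"
    by metis
  have W1: "\<exists>n. map a [0..<n] \<in> W i" if "a \<in> A i" for a i using W[of i] that by blast
  have W2: "emeasure Mu (W i) \<le> ennreal (e * (1/2) ^ Suc i)" for i using W[of i] by (rule conjunct2)
  have "emeasure Mu (\<Union>i. W i) \<le> (\<Sum>i. emeasure Mu (W i))"
    by (rule emeasure_subadditive_countably) simp
  also have "\<dots> \<le> (\<Sum>i. ennreal (e * (1/2) ^ Suc i))"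
    by (intro suminf_le W2 summableI)
  also have "\<dots> = ennreal e"
    using sums_mult[OF power_half_series, of e] \<open>e > 0\<close>
    by (subst suminf_ennreal2) (auto simp: sums_iff)
  finally have "emeasure Mu (\<Union>i. W i) \<le> ennreal e" .
  moreover have "\<forall>a\<in>\<Union>i. A i. \<exists>n. map a [0..<n] \<in> (\<Union>i. W i)"
    using W1 by fast
  ultimately show "\<exists>W. (\<forall>a\<in>\<Union>i. A i. \<exists>n. map a [0..<n] \<in> W) \<and> emeasure Mu W \<le> ennreal e"
    by blast
qed

lemma null_UN_countable:
  assumes "countable I" "\<And>i. i \<in> I \<Longrightarrow> null (A i)"
  shows "null (\<Union>i\<in>I. A i)"
proof (cases "I = {}")
  case True
  have "null {}" unfolding null_def by (auto intro: exI[of _ "{}"])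
  with True show ?thesis by simp
next
  case False
  have "null (\<Union>n. A (from_nat_into I n))"
    using assms(2) from_nat_into[OF False] by (intro null_UN) auto
  then show ?thesis
    by (rule null_subset) (use from_nat_into_surj[OF assms(1)] in force)
qed

lemma null_Un:
  assumes "null A" "null B" shows "null (A \<union> B)"
proof -
  have "null (\<Union>b. if b then A else B)" using assms by (intro null_UN_countable) auto
  then show ?thesis by (rule null_subset) auto
qed

text \<open>For each \<open>J\<close>, the words of all \<open>B j\<close> with
  \<open>j \<ge> J\<close> catch every such sequence, and their total weight is at most a tail of a
  convergent series. The lengths \<open>N j\<close> may be arbitrary.\<close>

lemma null_Borel_Cantelli:
  assumes B: "\<And>j. B j \<subseteq> words m (N j)" and c: "\<And>j. (\<Sum>w\<in>B j. mu w) \<le> c j" and "summable c"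
  shows "null {a. \<exists>\<^sub>F j in sequentially. map a [0..<N j] \<in> B j}"
  unfolding null_def
proof (intro allI impI)
  fix e :: real assume "e > 0"
  have fin: "finite (B j)" for j using B finite_words by (rule finite_subset)
  have mu_B: "0 \<le> mu w" if "w \<in> B j" for w j
    using subsetD[OF B that] by (rule mu_nonneg)
  have c_nonneg: "0 \<le> c j" for j
    by (rule order_trans[OF _ c]) (intro sum_nonneg mu_B)
  obtain J where J: "\<bar>\<Sum>i. c (i + J)\<bar> < e"
    using suminf_exist_split[OF \<open>e > 0\<close> \<open>summable c\<close>] unfolding real_norm_def by blast
  have "emeasure Mu (\<Union>i. B (i + J)) \<le> (\<Sum>i. emeasure Mu (B (i + J)))"
    by (rule emeasure_subadditive_countably) simp
  also have "\<dots> \<le> (\<Sum>i. ennreal (c (i + J)))"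
  proof (intro suminf_le)
    fix i
    have "emeasure Mu (B (i + J)) = ennreal (\<Sum>w\<in>B (i + J). mu w)"
      unfolding emeasure_Mu_finite[OF fin] by (intro sum_ennreal mu_B)
    also have "\<dots> \<le> ennreal (c (i + J))" by (rule ennreal_leI[OF c])
    finally show "emeasure Mu (B (i + J)) \<le> ennreal (c (i + J))" .
  qed auto
  also have "\<dots> = ennreal (\<Sum>i. c (i + J))"
    by (rule suminf_ennreal2[OF c_nonneg summable_ignore_initial_segment[OF \<open>summable c\<close>]])
  also have "\<dots> \<le> ennreal e" using J by (intro ennreal_leI) auto
  finally have "emeasure Mu (\<Union>i. B (i + J)) \<le> ennreal e" .
  moreover have cover: "\<exists>n. map a [0..<n] \<in> (\<Union>i. B (i + J))"
    if freq: "\<exists>\<^sub>F j in sequentially. map a [0..<N j] \<in> B j" for a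
  proof -
    obtain j where "j \<ge> J" "map a [0..<N j] \<in> B j"
      using freq unfolding frequently_sequentially by blast
    then show ?thesis by (intro exI[of _ "N j"] UN_I[of "j - J"]) auto
  qed
  ultimately show "\<exists>W. (\<forall>a\<in>{a. \<exists>\<^sub>F j in sequentially. map a [0..<N j] \<in> B j}. \<exists>n. map a [0..<n] \<in> W)
      \<and> emeasure Mu W \<le> ennreal e"
    by (intro exI[of _ "\<Union>i. B (i + J)"] conjI ballI cover) (auto simp del: UN_iff)
qed

text \<open>A family of words of total weight below 1 misses a sequence: one can always extend a word
  \<open>v\<close> by a letter while keeping the weight of the family below \<open>v\<close> smaller than \<open>mu v\<close>.\<close>

lemma not_null_sequences: "\<not> null (letter_sequences m)"
proof
  assume "null (letter_sequences m)"
  then have "\<exists>W. (\<forall>a\<in>letter_sequences m. \<exists>n. map a [0..<n] \<in> W) \<and> emeasure Mu W \<le> ennreal (1/2)"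
    unfolding null_def by - (drule spec[of _ "1/2::real"], simp)
  then obtain W where W: "\<And>a. a \<in> letter_sequences m \<Longrightarrow> \<exists>n. map a [0..<n] \<in> W"
    "emeasure Mu W \<le> ennreal (1/2)" by blast
  define ext where "ext v = {w :: nat list. take (length v) w = v}" for v
  define light where "light v \<longleftrightarrow> v \<in> words m (length v) \<and> emeasure Mu (W \<inter> ext v) < ennreal (mu v)" for v
  have step: "\<exists>c<m. light (v @ [c])" if v: "light v" for v
  proof (rule ccontr)
    assume not_light: "\<not> (\<exists>c<m. light (v @ [c]))"
    have vc: "v @ [c] \<in> words m (Suc (length v))" if "c < m" for c
      using v that by (auto simp: light_def words_def)
    have "\<not> light (v @ [c])" if "c < m" for c using not_light that by blast
    then have ge: "ennreal (mu (v @ [c])) \<le> emeasure Mu (W \<inter> ext (v @ [c]))" if "c < m" for c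
      using that vc[OF that] by (simp add: light_def not_less)
    have "ennreal (mu v) = ennreal (\<Sum>c<m. mu (v @ [c]))"
      using v sum_mu_children[of v "length v"] by (simp add: light_def)
    also have "\<dots> = (\<Sum>c<m. ennreal (mu (v @ [c])))"
      using vc mu_nonneg by (subst sum_ennreal) auto
    also have "\<dots> \<le> (\<Sum>c<m. emeasure Mu (W \<inter> ext (v @ [c])))"
      using ge by (intro sum_mono) auto
    also have "\<dots> = emeasure Mu (\<Union>c<m. W \<inter> ext (v @ [c]))"
    proof (rule sum_emeasure)
      show "disjoint_family_on (\<lambda>c. W \<inter> ext (v @ [c])) {..<m}"
        unfolding disjoint_family_on_def ext_def by auto
    qed auto
    also have "\<dots> \<le> emeasure Mu (W \<inter> ext v)"
    proof (rule emeasure_mono)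
      have "take (length v) w = v" if "take (Suc (length v)) w = v @ [c]" for w c
        using arg_cong[OF that, of "take (length v)"] by (simp add: min_def)
      then show "(\<Union>c<m. W \<inter> ext (v @ [c])) \<subseteq> W \<inter> ext v" unfolding ext_def by auto
    qed simp
    finally show False using v by (auto simp: light_def dest: leD)
  qed
  define f where "f = rec_nat [] (\<lambda>_ v. v @ [SOME c. c < m \<and> light (v @ [c])])"
  define a where "a n = (SOME c. c < m \<and> light (f n @ [c]))" for n
  have f_Suc: "f (Suc n) = f n @ [a n]" for n by (simp add: f_def a_def)
  have a: "a n < m \<and> light (f n @ [a n])" if "light (f n)" for n
    unfolding a_def by (rule someI_ex[OF step[OF that]])
  have "ennreal (1/2) < 1" by (subst ennreal_less_one_iff) simp
  moreover have "W \<inter> ext [] = W" by (simp add: ext_def)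
  ultimately have "emeasure Mu (W \<inter> ext []) < 1" using le_less_trans[OF W(2)] by simp
  then have "light []" by (simp add: light_def)
  moreover have f_0: "f 0 = []" by (simp add: f_def)
  ultimately have light_0: "light (f 0)" by simp
  have light_f: "light (f n)" for n
  proof (induction n)
    case (Suc n)
    then show ?case using a[of n] by (simp add: f_Suc)
  qed (rule light_0)
  have f: "f n = map a [0..<n]" for n
    by (induction n) (simp_all add: f_0 f_Suc)
  have "a \<in> letter_sequences m" using a[OF light_f] by (simp add: letter_sequences_def)
  then obtain n where "map a [0..<n] \<in> W" using W by blast
  \<comment> \<open>A word of the cover on the constructed path alone contributes
    \<open>mu (f n)\<close> below \<open>f n\<close>, against the strict inequality kept along the
    path.\<close>
  then have "{f n} \<subseteq> W \<inter> ext (f n)" by (simp add: f ext_def)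
  then have "emeasure Mu {f n} \<le> emeasure Mu (W \<inter> ext (f n))" by (rule emeasure_mono) simp
  then show False using light_f[of n] by (auto simp: light_def emeasure_Mu_finite dest: leD)
qed

end

section \<open>Almost every sequence has the prescribed block frequencies\<close>

text \<open>For \<open>n\<close> between two consecutive cubes, monotonicity bounds
  \<open>S n\<close> by the values at these cubes. The ratio of consecutive cubes tends to 1, so
  both bounds have the limit \<open>P\<close>.\<close>

lemma averages_tendsto_of_cubes:
  fixes S :: "nat \<Rightarrow> real"
  assumes mono: "incseq S" and nonneg: "\<And>n. 0 \<le> S n"
    and lim: "(\<lambda>j. S (Suc j ^ 3) / real (Suc j ^ 3)) \<longlonglongrightarrow> P"
  shows "(\<lambda>n. S n / real n) \<longlonglongrightarrow> P"
proof -
  have "\<exists>j. Suc j ^ 3 \<le> n \<and> n < Suc (Suc j) ^ 3" if "n > 0" for n :: nat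
  proof -
    define J where "J = {j. Suc j ^ 3 \<le> n}"
    have "x \<le> n" if "x \<in> J" for x
      using that self_le_power[of "Suc x" 3] by (simp add: J_def del: power_Suc)
    then have "J \<subseteq> {..n}" by auto
    then have fin: "finite J" by (rule finite_subset) simp
    have "0 \<in> J" using that by (simp add: J_def)
    then have "Max J \<in> J" using fin by (intro Max_in) auto
    moreover have "Suc (Max J) \<notin> J" using Max_ge[OF fin, of "Suc (Max J)"] by auto
    ultimately show ?thesis by (auto simp: J_def not_le)
  qed
  then obtain c where c: "\<And>n. n > 0 \<Longrightarrow> Suc (c n) ^ 3 \<le> n" "\<And>n. n > 0 \<Longrightarrow> n < Suc (Suc (c n)) ^ 3"
    by metis
  have c_top: "filterlim c at_top sequentially"
    unfolding filterlim_at_top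
  proof
    fix Z
    show "\<forall>\<^sub>F n in sequentially. Z \<le> c n"
      using eventually_ge_at_top[of "Suc (Suc Z ^ 3)"]
    proof eventually_elim
      case (elim n)
      then have "Suc Z ^ 3 < Suc (Suc (c n)) ^ 3" using c(2)[of n] by linarith
      then show ?case using power_less_imp_less_base[of "Suc Z" 3 "Suc (Suc (c n))"] by simp
    qed
  qed
  have ratio: "(\<lambda>j. real (Suc j ^ 3) / real (Suc (Suc j) ^ 3)) \<longlonglongrightarrow> 1"
    by real_asymp
  have ratio': "(\<lambda>j. real (Suc (Suc j) ^ 3) / real (Suc j ^ 3)) \<longlonglongrightarrow> 1"
    by real_asymp
  have "(\<lambda>j. S (Suc j ^ 3) / real (Suc j ^ 3) * (real (Suc j ^ 3) / real (Suc (Suc j) ^ 3))) \<longlonglongrightarrow> P * 1"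
    by (intro tendsto_mult lim ratio)
  then have "(\<lambda>j. S (Suc j ^ 3) / real (Suc (Suc j) ^ 3)) \<longlonglongrightarrow> P"
    by (simp del: power_Suc of_nat_power)
  from filterlim_compose[OF this c_top]
  have lower: "(\<lambda>n. S (Suc (c n) ^ 3) / real (Suc (Suc (c n)) ^ 3)) \<longlonglongrightarrow> P" .
  have "(\<lambda>j. S (Suc (Suc j) ^ 3) / real (Suc (Suc j) ^ 3) * (real (Suc (Suc j) ^ 3) / real (Suc j ^ 3))) \<longlonglongrightarrow> P * 1"
    by (intro tendsto_mult LIMSEQ_Suc[OF lim] ratio')
  then have "(\<lambda>j. S (Suc (Suc j) ^ 3) / real (Suc j ^ 3)) \<longlonglongrightarrow> P"
    by (simp del: power_Suc of_nat_power)
  from filterlim_compose[OF this c_top]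
  have upper: "(\<lambda>n. S (Suc (Suc (c n)) ^ 3) / real (Suc (c n) ^ 3)) \<longlonglongrightarrow> P" .
  show ?thesis
  proof (rule tendsto_sandwich[OF _ _ lower upper])
    show "\<forall>\<^sub>F n in sequentially. S (Suc (c n) ^ 3) / real (Suc (Suc (c n)) ^ 3) \<le> S n / real n"
      using eventually_gt_at_top[of 0]
    proof eventually_elim
      case (elim n)
      have le: "n \<le> Suc (Suc (c n)) ^ 3" by (rule less_imp_le[OF c(2)[OF elim]])
      show ?case
        using incseqD[OF mono c(1)[OF elim]] nonneg elim le
        by (intro frac_le) (auto simp del: power_Suc of_nat_power)
    qed
    show "\<forall>\<^sub>F n in sequentially. S n / real n \<le> S (Suc (Suc (c n)) ^ 3) / real (Suc (c n) ^ 3)"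
      using eventually_gt_at_top[of 0]
    proof eventually_elim
      case (elim n)
      have le: "n \<le> Suc (Suc (c n)) ^ 3" by (rule less_imp_le[OF c(2)[OF elim]])
      show ?case
        using incseqD[OF mono le] c(1)[OF elim] nonneg elim
        by (intro frac_le) (auto simp del: power_Suc of_nat_power)
    qed
  qed
qed

section \<open>Pairs of blocks that nearly coincide\<close>

text \<open>The growth conditions with the times numbered from 0. Strict monotonicity of each time
  function enters as injectivity, the form suited to counting.\<close>

locale block_times =
  fixes l :: nat and p :: "nat \<Rightarrow> nat \<Rightarrow> nat" and \<epsilon> :: real
  assumes \<epsilon>: "0 < \<epsilon>" "\<epsilon> \<le> 1"
    and p_ge: "k \<ge> 1 \<Longrightarrow> i < l \<Longrightarrow> k \<le> p i k"
    and p_gap: "k \<ge> 1 \<Longrightarrow> i < j \<Longrightarrow> j < l \<Longrightarrow> real (p i k) + \<epsilon> * real k \<le> real (p j k)"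
    and p_inj: "k \<ge> 1 \<Longrightarrow> k' \<ge> 1 \<Longrightarrow> i < l \<Longrightarrow> p i k = p i k' \<Longrightarrow> k = k'"
begin

text \<open>Two ways to lose independence at separation \<open>d\<close>: one of the blocks is so
  early that its own times may lie within \<open>d\<close> of each other, or some time of one block
  is within \<open>d\<close> of some time of the other.\<close>

definition resonant :: "nat \<Rightarrow> nat \<Rightarrow> nat \<Rightarrow> bool" where
  "resonant d k k' \<longleftrightarrow> \<epsilon> * k \<le> d \<or> \<epsilon> * k' \<le> d \<or>
     (\<exists>i<l. \<exists>j<l. p i k \<le> p j k' + d \<and> p j k' \<le> p i k + d)"

lemma card_early: "real (card {k\<in>{1..n}. \<epsilon> * real k \<le> d}) \<le> d / \<epsilon>" if "d \<ge> 0" for d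
proof -
  have "{k\<in>{1..n}. \<epsilon> * real k \<le> d} \<subseteq> {1..nat \<lfloor>d / \<epsilon>\<rfloor>}"
    using \<epsilon> by (auto simp: le_nat_floor field_simps)
  from card_mono[OF _ this] have "card {k\<in>{1..n}. \<epsilon> * real k \<le> d} \<le> nat \<lfloor>d / \<epsilon>\<rfloor>"
    by simp
  moreover have "real (nat \<lfloor>d / \<epsilon>\<rfloor>) \<le> d / \<epsilon>" using that \<epsilon> by (intro of_nat_floor) simp
  ultimately show ?thesis by linarith
qed

lemma card_near:
  assumes "j < l"
  shows "card {k'\<in>{1..n}. x \<le> p j k' + d \<and> p j k' \<le> x + d} \<le> 2 * d + 1"
proof -
  have "card {k'\<in>{1..n}. x \<le> p j k' + d \<and> p j k' \<le> x + d} \<le> card {x - d..x + d}"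
  proof (rule card_inj_on_le[of "p j"])
    show "inj_on (p j) {k'\<in>{1..n}. x \<le> p j k' + d \<and> p j k' \<le> x + d}"
      by (rule inj_onI) (auto intro: p_inj[OF _ _ assms])
  qed auto
  then show ?thesis by simp
qed

text \<open>At most \<open>d / \<epsilon>\<close> indices are early, and each of them spoils at most
  \<open>2 * n\<close> pairs. For a fixed \<open>k\<close>, each of the \<open>l * l\<close> choices
  of coordinates admits at most \<open>2 * d + 1\<close> indices \<open>k'\<close>, by injectivity.
  The bound is therefore linear in \<open>n\<close>, against \<open>n * n\<close> pairs in
  total.\<close>

lemma card_resonant:
  "real (card {(k, k'). k \<in> {1..n} \<and> k' \<in> {1..n} \<and> resonant d k k'})
     \<le> real n * (2 * (d / \<epsilon>) + real (l * l * (2 * d + 1)))"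
proof -
  define E where "E = {k\<in>{1..n}. \<epsilon> * real k \<le> real d}"
  define T where "T k = (\<Union>i<l. \<Union>j<l. {k'\<in>{1..n}. p i k \<le> p j k' + d \<and> p j k' \<le> p i k + d})" for k
  have fin_E: "finite E" by (simp add: E_def)
  have fin_T: "finite (T k)" for k by (auto simp: T_def)
  have "card (T k) \<le> (\<Sum>i<l. \<Sum>j<l. 2 * d + 1)" for k
    unfolding T_def by (intro order_trans[OF card_UN_le] sum_mono card_near) auto
  then have card_T: "card (T k) \<le> l * l * (2 * d + 1)" for k by (simp add: algebra_simps)
  have "{(k, k'). k \<in> {1..n} \<and> k' \<in> {1..n} \<and> resonant d k k'}
      \<subseteq> E \<times> {1..n} \<union> {1..n} \<times> E \<union> Sigma {1..n} T" (is "?A \<subseteq> ?B")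
    unfolding resonant_def E_def T_def by auto
  then have "card ?A \<le> card ?B" using fin_E fin_T by (intro card_mono) auto
  also have "\<dots> \<le> card (E \<times> {1..n}) + card ({1..n} \<times> E) + card (Sigma {1..n} T)"
    by (intro order_trans[OF card_Un_le] add_right_mono card_Un_le)
  also have "card (Sigma {1..n} T) = (\<Sum>k\<in>{1..n}. card (T k))"
    using fin_T by (intro card_SigmaI) auto
  also have "\<dots> \<le> n * (l * l * (2 * d + 1))"
    using sum_mono[of "{1..n}" "\<lambda>k. card (T k)" "\<lambda>_. l * l * (2 * d + 1)"] card_T by simp
  finally have "card ?A \<le> 2 * card E * n + n * (l * l * (2 * d + 1))"
    by (simp add: card_cartesian_product mult.commute mult_2)
  then have "real (card ?A) \<le> real (2 * card E * n + n * (l * l * (2 * d + 1)))"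
    by (rule of_nat_mono)
  also have "\<dots> = real n * (2 * real (card E) + real (l * l * (2 * d + 1)))"
    by (simp add: algebra_simps)
  also have "\<dots> \<le> real n * (2 * (d / \<epsilon>) + real (l * l * (2 * d + 1)))"
    using card_early[of "real d" n] by (intro mult_left_mono add_right_mono) (auto simp: E_def)
  finally show ?thesis .
qed

end

text \<open>Gaps between non-adjacent times follow by adding up nonnegative gaps. Integers that grow
  by at least \<epsilon> > 0 grow strictly, whence injectivity, and
  \<open>n \<le> t (Suc i) n\<close> holds because the first time is the identity.\<close>

lemma admissible_block_times:
  assumes "admissible_times l t" "l \<ge> 1" "\<forall>n\<ge>1. t 1 n = n"
  obtains \<epsilon> where "block_times l (\<lambda>i. t (Suc i)) \<epsilon>"
proof -
  obtain \<epsilon> :: real where \<epsilon>: "0 < \<epsilon>" "\<epsilon> \<le> 1"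
    and gap: "\<And>n i. n \<ge> 1 \<Longrightarrow> i \<in> {2..l} \<Longrightarrow> real (t (i - 1) n) + \<epsilon> * real n \<le> real (t i n)"
    and step: "\<And>n i. n \<ge> 1 \<Longrightarrow> i \<in> {1..l} \<Longrightarrow> real (t i n) + \<epsilon> \<le> real (t i (n + 1))"
    using assms(1) unfolding admissible_times_def by blast
  have gap': "real (t (Suc i) n) + \<epsilon> * real n \<le> real (t (Suc j) n)" if "n \<ge> 1" "i < j" "j < l" for n i j
    using that(2,3)
  proof (induction j)
    case (Suc j)
    have next_gap: "real (t (Suc j) n) + \<epsilon> * real n \<le> real (t (Suc (Suc j)) n)"
      using gap[OF that(1), of "Suc (Suc j)"] Suc.prems by simp
    show ?case
    proof (cases "i = j")
      case False
      moreover have "0 \<le> \<epsilon> * real n" using \<epsilon> by simp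
      ultimately show ?thesis using Suc next_gap by simp
    qed (use next_gap in simp)
  qed simp
  have "block_times l (\<lambda>i. t (Suc i)) \<epsilon>"
  proof
    fix n i assume n: "n \<ge> (1 :: nat)" "i < l"
    show "n \<le> t (Suc i) n"
    proof (cases "i = 0")
      case False
      then have "real (t 1 n) + \<epsilon> * real n \<le> real (t (Suc i) n)" using gap'[OF n(1), of 0 i] n(2) by simp
      moreover have "0 \<le> \<epsilon> * real n" using \<epsilon> by simp
      moreover have "t 1 n = n" using assms(3) n(1) by simp
      ultimately show ?thesis by simp
    qed (use assms(3) n in simp)
  next
    fix n n' i assume n: "n \<ge> (1 :: nat)" "n' \<ge> 1" "i < l" "t (Suc i) n = t (Suc i) n'"
    have less: "t (Suc i) x < t (Suc i) y" if "x \<ge> 1" "x < y" for x y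
      using that(2)
    proof (induction y)
      case (Suc y)
      then have "y \<ge> 1" using that(1) by simp
      then have "t (Suc i) y < t (Suc i) (Suc y)" using step[of y "Suc i"] n(3) \<epsilon> by simp
      with Suc show ?case by (cases "x = y") auto
    qed simp
    show "n = n'" using less[OF n(1), of n'] less[OF n(2), of n] n(4) by (cases n n' rule: linorder_cases) auto
  qed (use \<epsilon> gap' in auto)
  then show ?thesis by (rule that)
qed

section \<open>Variance of block counts\<close>

locale block_chain = mixing_chain + block_times
begin

definition block :: "(nat \<Rightarrow> nat \<Rightarrow> nat \<Rightarrow> real) \<Rightarrow> nat \<Rightarrow> (nat \<Rightarrow> nat) \<Rightarrow> real" where
  "block \<phi> n a = (\<Prod>i<l. \<phi> i (a (p i n)) (a (Suc (p i n))))"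

definition block_mean :: "(nat \<Rightarrow> nat \<Rightarrow> nat \<Rightarrow> real) \<Rightarrow> real" where
  "block_mean \<phi> = (\<Prod>i<l. pair_mean (\<phi> i))"

context
  fixes \<phi> :: "nat \<Rightarrow> nat \<Rightarrow> nat \<Rightarrow> real"
  assumes \<phi>: "\<And>i x y. 0 \<le> \<phi> i x y \<and> \<phi> i x y \<le> 1"
begin

lemma block_bounds: "0 \<le> block \<phi> n a \<and> block \<phi> n a \<le> 1"
  unfolding block_def using \<phi> by (auto intro!: prod_nonneg prod_le_1)

lemma block_mean_bounds: "0 \<le> block_mean \<phi> \<and> block_mean \<phi> \<le> 1"
  unfolding block_mean_def using \<phi> pair_mean_bounds by (auto intro!: prod_nonneg prod_le_1)

text \<open>For a non-resonant pair all \<open>2 * l\<close> positions of the two blocks are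
  separated by more than \<open>d\<close>, so the product formula applies to both blocks together
  and to each one alone. The errors \<open>2 * l\<close>, \<open>l\<close> and \<open>l\<close> add
  up to the constant \<open>4 * l\<close>.\<close>

lemma block_covariance:
  assumes d: "d = k * n" "n > 0" and "x \<ge> 1" "y \<ge> 1" and "\<not> resonant d x y"
    and N: "\<And>i. i < l \<Longrightarrow> Suc (Suc (p i x)) \<le> N" "\<And>i. i < l \<Longrightarrow> Suc (Suc (p i y)) \<le> N"
  shows "expect N (\<lambda>a. (block \<phi> x a - block_mean \<phi>) * (block \<phi> y a - block_mean \<phi>))
           \<le> 4 * real l * (1 - \<delta>) ^ n"
proof -
  define \<eta> where "\<eta> = (1 - \<delta>) ^ n"
  define M where "M = block_mean \<phi>"
  have M: "0 \<le> M" "M \<le> 1" using block_mean_bounds by (auto simp: M_def)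
  have res: "d < \<epsilon> * x" "d < \<epsilon> * y"
    "\<And>i j. i < l \<Longrightarrow> j < l \<Longrightarrow> p i x + d < p j y \<or> p j y + d < p i x"
    using \<open>\<not> resonant d x y\<close> unfolding resonant_def by (auto simp: not_le)
  have late: "d \<le> p i z" if "d < \<epsilon> * z" "z \<ge> 1" "i < l" for i z
  proof -
    have "\<epsilon> * real z \<le> 1 * real z" using \<epsilon> by (intro mult_right_mono) auto
    then show ?thesis using p_ge[OF that(2,3)] that(1) by linarith
  qed
  have gap: "p i z + d < p j z \<or> p j z + d < p i z"
    if "d < \<epsilon> * z" "z \<ge> 1" "i < l" "j < l" "i \<noteq> j" for i j z
  proof (cases "i < j")
    case True
    from p_gap[OF that(2) this that(4)] that(1) show ?thesis by linarith
  next
    case False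
    with that(5) have "j < i" by simp
    from p_gap[OF that(2) this that(3)] that(1) show ?thesis by linarith
  qed
  have single: "\<bar>expect N (block \<phi> z) - M\<bar> \<le> l * \<eta>"
    if "d < \<epsilon> * z" "z \<ge> 1" "\<And>i. i < l \<Longrightarrow> Suc (Suc (p i z)) \<le> N" for z
  proof -
    have "\<bar>expect N (\<lambda>a. \<Prod>i<l. \<phi> i (a (p i z)) (a (Suc (p i z)))) - (\<Prod>i<l. pair_mean (\<phi> i))\<bar>
        \<le> card {..<l} * (1 - \<delta>) ^ n"
    proof (rule expect_prod[where d = d])
      show "d \<le> p i z" if "i \<in> {..<l}" for i
        by (rule late) (use that \<open>d < \<epsilon> * z\<close> \<open>z \<ge> 1\<close> in auto)
      show "p i z + d < p j z \<or> p j z + d < p i z" if "i \<in> {..<l}" "j \<in> {..<l}" "i \<noteq> j" for i j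
        by (rule gap) (use that \<open>d < \<epsilon> * z\<close> \<open>z \<ge> 1\<close> in auto)
      show "Suc (Suc (p i z)) \<le> N" if "i \<in> {..<l}" for i
        using that \<open>\<And>i. i < l \<Longrightarrow> Suc (Suc (p i z)) \<le> N\<close> by blast
    qed (rule d \<phi> finite_lessThan)+
    then show ?thesis by (simp add: block_def[abs_def] block_mean_def M_def \<eta>_def)
  qed
  \<comment> \<open>The Boolean selects the block, so that the two blocks form one family of
    \<open>2 * l\<close> pairs.\<close>
  have "\<bar>expect N (\<lambda>a. \<Prod>(b, i)\<in>UNIV \<times> {..<l}. \<phi> i (a (p i (if b then x else y))) (a (Suc (p i (if b then x else y)))))
      - (\<Prod>(b :: bool, i)\<in>UNIV \<times> {..<l}. pair_mean (\<phi> i))\<bar> \<le> card ((UNIV :: bool set) \<times> {..<l}) * (1 - \<delta>) ^ n"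
    unfolding case_prod_beta
  proof (rule expect_prod[where d = d])
    fix u v :: "bool \<times> nat"
    assume uv: "u \<in> UNIV \<times> {..<l}" "v \<in> UNIV \<times> {..<l}" "u \<noteq> v"
    obtain b i c j where [simp]: "u = (b, i)" "v = (c, j)" by (cases u, cases v)
    show "p (snd u) (if fst u then x else y) + d < p (snd v) (if fst v then x else y) \<or>
          p (snd v) (if fst v then x else y) + d < p (snd u) (if fst u then x else y)"
      using uv res(3)[of i j] res(3)[of j i] gap[OF res(1) \<open>x \<ge> 1\<close>, of i j] gap[OF res(2) \<open>y \<ge> 1\<close>, of i j]
      by (cases b; cases c) auto
  next
    fix u :: "bool \<times> nat"
    assume u: "u \<in> UNIV \<times> {..<l}"
    then show "d \<le> p (snd u) (if fst u then x else y)"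
      using late[OF res(1) \<open>x \<ge> 1\<close>, of "snd u"] late[OF res(2) \<open>y \<ge> 1\<close>, of "snd u"] by auto
    from u show "Suc (Suc (p (snd u) (if fst u then x else y))) \<le> N"
      using N[of "snd u"] by auto
  qed (rule d \<phi> | simp)+
  then have pair: "\<bar>expect N (\<lambda>a. block \<phi> x a * block \<phi> y a) - M * M\<bar> \<le> 2 * l * \<eta>"
    by (simp add: prod.cartesian_product[symmetric] UNIV_bool block_def block_mean_def M_def \<eta>_def card_cartesian_product mult.commute)
  have "(\<lambda>a. (block \<phi> x a - M) * (block \<phi> y a - M)) =
    (\<lambda>a. block \<phi> x a * block \<phi> y a - block \<phi> x a * M - block \<phi> y a * M + M * M)"
    by (simp add: algebra_simps)
  then have "expect N (\<lambda>a. (block \<phi> x a - M) * (block \<phi> y a - M)) =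
    expect N (\<lambda>a. block \<phi> x a * block \<phi> y a) - expect N (block \<phi> x) * M - expect N (block \<phi> y) * M + M * M"
    by (simp add: expect_add expect_diff expect_mult_right)
  also have "\<dots> = (expect N (\<lambda>a. block \<phi> x a * block \<phi> y a) - M * M)
      + (M - expect N (block \<phi> x)) * M + (M - expect N (block \<phi> y)) * M"
    by (simp add: algebra_simps)
  also have "\<dots> \<le> 2 * l * \<eta> + l * \<eta> * 1 + l * \<eta> * 1"
  proof (intro add_mono mult_mono)
    show "expect N (\<lambda>a. block \<phi> x a * block \<phi> y a) - M * M \<le> 2 * l * \<eta>" using pair by linarith
    show "M - expect N (block \<phi> x) \<le> l * \<eta>" "M - expect N (block \<phi> y) \<le> l * \<eta>"
      using single[OF res(1) \<open>x \<ge> 1\<close> N(1)] single[OF res(2) \<open>y \<ge> 1\<close> N(2)] by (simp_all add: abs_le_iff)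
    show "0 \<le> real l * \<eta>" "0 \<le> real l * \<eta>" using \<delta>_le_1 by (auto simp: \<eta>_def)
  qed (use M in auto)
  finally show ?thesis by (simp add: M_def \<eta>_def)
qed

text \<open>In the expanded square, resonant pairs are estimated trivially by 1 and counted; all
  others obey the covariance bound.\<close>

lemma block_second_moment:
  assumes "j > 0" and N: "\<And>x i. x \<in> {1..n} \<Longrightarrow> i < l \<Longrightarrow> Suc (Suc (p i x)) \<le> N"
  shows "expect N (\<lambda>a. (\<Sum>x=1..n. block \<phi> x a - block_mean \<phi>)\<^sup>2)
    \<le> real n * (2 * (real (k * j) / \<epsilon>) + real (l * l * (2 * (k * j) + 1))) + (real n)\<^sup>2 * (4 * real l * (1 - \<delta>) ^ j)"
proof -
  define X where "X x a = block \<phi> x a - block_mean \<phi>" for x a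
  define c where "c = 4 * real l * (1 - \<delta>) ^ j"
  define A where "A = {(x, y). x \<in> {1..n} \<and> y \<in> {1..n} \<and> resonant (k * j) x y}"
  have c: "0 \<le> c" using \<delta>_le_1 by (simp add: c_def)
  have A: "A \<subseteq> {1..n} \<times> {1..n}" by (auto simp: A_def)
  have "expect N (\<lambda>a. (\<Sum>x=1..n. X x a)\<^sup>2) = (\<Sum>(x, y)\<in>{1..n} \<times> {1..n}. expect N (\<lambda>a. X x a * X y a))"
    by (simp add: power2_eq_square sum_product expect_sum sum.cartesian_product case_prod_unfold)
  also have "\<dots> \<le> (\<Sum>z\<in>{1..n} \<times> {1..n}. indicator A z + c)"
  proof (rule sum_mono)
    fix z assume z: "z \<in> {1..n} \<times> {1..n}"
    obtain x y where [simp]: "z = (x, y)" by (cases z)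
    show "(case z of (x, y) \<Rightarrow> expect N (\<lambda>a. X x a * X y a)) \<le> indicator A z + c"
    proof (cases "z \<in> A")
      case True
      have "\<bar>X x a\<bar> \<le> 1" for x a
        using block_bounds[of x a] block_mean_bounds by (auto simp: X_def abs_le_iff)
      then have "\<bar>X x a * X y a\<bar> \<le> 1" for a
        unfolding abs_mult by (intro mult_le_one) auto
      then have "\<bar>expect N (\<lambda>a. X x a * X y a)\<bar> \<le> 1" by (intro expect_bound)
      then show ?thesis using True c by simp
    next
      case False
      then have "expect N (\<lambda>a. X x a * X y a) \<le> c"
        unfolding X_def c_def using z assms by (intro block_covariance[OF refl]) (auto simp: A_def)
      then show ?thesis using False by simp
    qed
  qed
  also have "\<dots> = (\<Sum>z\<in>{1..n} \<times> {1..n}. indicator A z) + (real n)\<^sup>2 * c"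
    by (simp add: sum.distrib power2_eq_square)
  also have "(\<Sum>z\<in>{1..n} \<times> {1..n}. indicator A z) = (\<Sum>z\<in>A. 1 :: real)"
    using A by (intro sum.mono_neutral_cong_right) auto
  also have "\<dots> = real (card A)" by simp
  also have "real (card A) \<le> real n * (2 * (real (k * j) / \<epsilon>) + real (l * l * (2 * (k * j) + 1)))"
    unfolding A_def by (rule card_resonant)
  finally show ?thesis by (simp add: X_def c_def)
qed

lemma null_block_deviation:
  assumes "e > 0"
  shows "null {a\<in>letter_sequences m. \<exists>\<^sub>F j in sequentially. e \<le> \<bar>(\<Sum>x=1..Suc j ^ 3. block \<phi> x a) / real (Suc j ^ 3) - block_mean \<phi>\<bar>}"
proof -
  define n where "n j = Suc j ^ 3" for j
  \<comment> \<open>The sum of all positions read serves as a bound for their maximum: words of this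
    length contain both letters of every pair.\<close>
  define N where "N j = Suc (Suc (\<Sum>x=1..n j. \<Sum>i<l. p i x))" for j
  define \<Phi> where "\<Phi> j a = (\<Sum>x=1..n j. block \<phi> x a - block_mean \<phi>)" for j a
  define B where "B j = {w\<in>words m (N j). real (n j) * e \<le> \<bar>\<Phi> j ((!) w)\<bar>}" for j
  \<comment> \<open>Chosen so that \<open>Suc j * D\<close> dominates the resonance count per index
    at separation \<open>k * Suc j\<close>.\<close>
  define D where "D = 2 * (real k / \<epsilon>) + real (l * l * (2 * k + 1))"
  \<comment> \<open>Chebyshev divides by \<open>(n j * e)^2\<close>. With
    \<open>n j = Suc j ^ 3\<close> the resonant part \<open>n j * Suc j * D\<close> becomes
    \<open>D / (Suc j)^2\<close>, apart from the factor \<open>1 / e^2\<close>.\<close>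
  define c where "c j = (D / (real (Suc j))\<^sup>2 + 4 * real l * (1 - \<delta>) ^ Suc j) / e\<^sup>2" for j
  have N: "Suc (Suc (p i x)) \<le> N j" if "x \<in> {1..n j}" "i < l" for i j x
  proof -
    have "p i x \<le> (\<Sum>i<l. p i x)" using that by (intro member_le_sum) auto
    also have "\<dots> \<le> (\<Sum>x=1..n j. \<Sum>i<l. p i x)"
      by (rule member_le_sum[OF that(1), of "\<lambda>x. \<Sum>i<l. p i x"]) auto
    finally show ?thesis by (simp add: N_def)
  qed
  have n_pos: "0 < real (n j)" for j by (simp add: n_def)
  have bound: "(\<Sum>w\<in>B j. mu w) \<le> c j" for j
  proof -
    have "(\<Sum>w\<in>B j. mu w) \<le> expect (N j) (\<lambda>a. (\<Phi> j a)\<^sup>2) / (real (n j) * e)\<^sup>2"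
      unfolding B_def using n_pos \<open>e > 0\<close> by (intro chebyshev) auto
    also have "\<dots> \<le> (real (n j) * (2 * (real (k * Suc j) / \<epsilon>) + real (l * l * (2 * (k * Suc j) + 1)))
        + (real (n j))\<^sup>2 * (4 * real l * (1 - \<delta>) ^ Suc j)) / (real (n j) * e)\<^sup>2"
      unfolding \<Phi>_def by (intro divide_right_mono block_second_moment N) auto
    also have "\<dots> \<le> (real (n j) * (real (Suc j) * D) + (real (n j))\<^sup>2 * (4 * real l * (1 - \<delta>) ^ Suc j)) / (real (n j) * e)\<^sup>2"
    proof (intro divide_right_mono add_right_mono mult_left_mono)
      have "real (l * l * (2 * (k * Suc j) + 1)) \<le> real (l * l * (Suc j * (2 * k + 1)))"
        by (intro of_nat_mono mult_left_mono) (auto simp: algebra_simps)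
      also have "\<dots> = real (Suc j) * real (l * l * (2 * k + 1))" by (simp only: of_nat_mult mult_ac)
      finally show "2 * (real (k * Suc j) / \<epsilon>) + real (l * l * (2 * (k * Suc j) + 1)) \<le> real (Suc j) * D"
        unfolding D_def by (simp only: of_nat_mult ring_distribs) (simp add: mult_ac)
    qed auto
    also have "\<dots> = c j"
    proof -
      define J where "J = real (Suc j)"
      have J: "real (n j) = J ^ 3" "J \<noteq> 0" by (simp_all add: n_def J_def)
      show ?thesis unfolding c_def J_def[symmetric] J(1) using J(2) \<open>e > 0\<close>
        by (simp add: field_simps power2_eq_square power3_eq_cube)
    qed
    finally show ?thesis .
  qed
  have "summable (\<lambda>j. D * (1 / (real (Suc j))\<^sup>2) + 4 * real l * ((1 - \<delta>) * (1 - \<delta>) ^ j))"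
  proof (intro summable_add summable_mult)
    show "summable (\<lambda>j. 1 / (real (Suc j))\<^sup>2)" using inverse_squares_sums[THEN sums_summable] by (simp add: add.commute)
    show "summable (\<lambda>j. (1 - \<delta>) ^ j)" using \<delta>_le_1 \<delta>_pos by (intro summable_geometric) auto
  qed
  then have "summable c" unfolding c_def[abs_def] by (intro summable_divide) simp
  have "null {a. \<exists>\<^sub>F j in sequentially. map a [0..<N j] \<in> B j}"
    by (rule null_Borel_Cantelli[OF _ bound \<open>summable c\<close>]) (auto simp: B_def)
  moreover have "map a [0..<N j] \<in> B j"
    if "a \<in> letter_sequences m" "e \<le> \<bar>(\<Sum>x=1..n j. block \<phi> x a) / real (n j) - block_mean \<phi>\<bar>" for a j
  proof -
    have "block \<phi> x ((!) (map a [0..<N j])) = block \<phi> x a" if "x \<in> {1..n j}" for x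
      unfolding block_def
    proof (rule prod.cong[OF refl])
      fix i assume "i \<in> {..<l}"
      with N[OF that, of i] have "p i x < N j" "Suc (p i x) < N j" by auto
      then show "\<phi> i (map a [0..<N j] ! p i x) (map a [0..<N j] ! Suc (p i x)) = \<phi> i (a (p i x)) (a (Suc (p i x)))"
        by simp
    qed
    then have "\<Phi> j ((!) (map a [0..<N j])) = \<Phi> j a" by (simp add: \<Phi>_def)
    also have "\<dots> = real (n j) * ((\<Sum>x=1..n j. block \<phi> x a) / real (n j) - block_mean \<phi>)"
      using n_pos[of j] by (simp add: \<Phi>_def sum_subtractf right_diff_distrib)
    finally have "real (n j) * e \<le> \<bar>\<Phi> j ((!) (map a [0..<N j]))\<bar>"
      using that(2) n_pos[of j] by (simp add: abs_mult)
    then show ?thesis using map_in_words[OF that(1)] by (simp add: B_def)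
  qed
  ultimately show ?thesis
    unfolding n_def[symmetric] by (elim null_subset) (auto elim!: frequently_elim1)
qed

lemma null_block_average:
  "null {a\<in>letter_sequences m. \<not> (\<lambda>n. (\<Sum>x=1..n. block \<phi> x a) / real n) \<longlonglongrightarrow> block_mean \<phi>}"
proof (rule null_subset)
  define A where "A r = {a\<in>letter_sequences m. \<exists>\<^sub>F j in sequentially.
    1 / real (Suc r) \<le> \<bar>(\<Sum>x=1..Suc j ^ 3. block \<phi> x a) / real (Suc j ^ 3) - block_mean \<phi>\<bar>}" for r
  show "null (\<Union>r. A r)"
    unfolding A_def by (intro null_UN null_block_deviation) simp
  show "{a\<in>letter_sequences m. \<not> (\<lambda>n. (\<Sum>x=1..n. block \<phi> x a) / real n) \<longlonglongrightarrow> block_mean \<phi>} \<subseteq> (\<Union>r. A r)"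
  proof (rule subsetI, rule ccontr)
    fix a assume a: "a \<in> {a\<in>letter_sequences m. \<not> (\<lambda>n. (\<Sum>x=1..n. block \<phi> x a) / real n) \<longlonglongrightarrow> block_mean \<phi>}"
      "a \<notin> (\<Union>r. A r)"
    have "(\<lambda>j. (\<Sum>x=1..Suc j ^ 3. block \<phi> x a) / real (Suc j ^ 3)) \<longlonglongrightarrow> block_mean \<phi>"
    proof (rule tendstoI)
      fix e :: real assume "e > 0"
      then obtain r where r: "1 / real (Suc r) < e" by (rule nat_approx_posE)
      have "\<not> (\<exists>\<^sub>F j in sequentially. 1 / real (Suc r) \<le> \<bar>(\<Sum>x=1..Suc j ^ 3. block \<phi> x a) / real (Suc j ^ 3) - block_mean \<phi>\<bar>)"
        using a by (auto simp: A_def)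
      then have "\<forall>\<^sub>F j in sequentially. \<not> 1 / real (Suc r) \<le> \<bar>(\<Sum>x=1..Suc j ^ 3. block \<phi> x a) / real (Suc j ^ 3) - block_mean \<phi>\<bar>"
        by (simp only: not_frequently)
      then show "\<forall>\<^sub>F j in sequentially. dist ((\<Sum>x=1..Suc j ^ 3. block \<phi> x a) / real (Suc j ^ 3)) (block_mean \<phi>) < e"
        by (rule eventually_mono) (use r in \<open>simp add: dist_real_def del: power_Suc of_nat_power of_nat_Suc\<close>)
    qed
    note lim = this
    have "incseq (\<lambda>n. \<Sum>x=1..n. block \<phi> x a)"
      by (rule incseq_SucI) (simp add: block_bounds)
    moreover have "0 \<le> (\<Sum>x=1..n. block \<phi> x a)" for n
      by (intro sum_nonneg) (simp add: block_bounds)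
    ultimately have "(\<lambda>n. (\<Sum>x=1..n. block \<phi> x a) / real n) \<longlonglongrightarrow> block_mean \<phi>"
      using lim by (rule averages_tendsto_of_cubes[where S = "\<lambda>n. \<Sum>x=1..n. block \<phi> x a"])
    with a(1) show False by simp
  qed
qed

end

end

section \<open>Hausdorff measure and base expansions\<close>

text \<open>Covers are defined as sequences. A countable, possibly finite, family is enumerated and
  the free places are filled with the empty set, which weighs 0 for every \<open>s\<close>. Finite
  subfamilies suffice because the series is the supremum of its partial sums.\<close>

lemma hausdorff_pre_measure_le:
  assumes "countable I" "A \<subseteq> (\<Union>i\<in>I. U i)" "0 \<le> d"
    and U: "\<And>i. i \<in> I \<Longrightarrow> bounded (U i) \<and> diameter (U i) \<le> d"
    and sum: "\<And>F. finite F \<Longrightarrow> F \<subseteq> I \<Longrightarrow> (\<Sum>i\<in>F. diam_weight s (U i)) \<le> K"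
  shows "hausdorff_pre_measure s d A \<le> K"
proof -
  define f where "f = to_nat_on I"
  define g where "g = inv_into I f"
  have inj: "inj_on f I" using \<open>countable I\<close> by (simp add: f_def inj_on_to_nat_on)
  define V where "V n = (if n \<in> f ` I then U (g n) else {})" for n
  have g: "g n \<in> I" if "n \<in> f ` I" for n using that by (simp add: g_def inv_into_into)
  have V_f: "V (f i) = U i" if "i \<in> I" for i
    using that inj by (simp add: V_def g_def)
  have "V \<in> delta_covers d A"
    unfolding delta_covers_def
  proof (intro CollectI conjI allI subsetI)
    fix x assume "x \<in> A"
    then obtain i where i: "i \<in> I" "x \<in> U i" using assms(2) by blast
    then have "x \<in> V (f i)" by (simp add: V_f)
    then show "x \<in> (\<Union>n. V n)" by blast
  next
    fix n
    show "bounded (V n)" using U g by (simp add: V_def)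
    show "diameter (V n) \<le> d" using U g \<open>0 \<le> d\<close> by (simp add: V_def diameter_empty)
  qed
  then have "hausdorff_pre_measure s d A \<le> (\<Sum>n. diam_weight s (V n))"
    unfolding hausdorff_pre_measure_def by (rule INF_lower)
  also have "\<dots> \<le> K"
    unfolding suminf_eq_SUP
  proof (rule SUP_least)
    fix N
    have "(\<Sum>n<N. diam_weight s (V n)) = (\<Sum>n\<in>{..<N} \<inter> f ` I. diam_weight s (V n))"
      by (rule sum.mono_neutral_right) (auto simp: V_def diam_weight_def)
    also have "\<dots> = (\<Sum>n\<in>{..<N} \<inter> f ` I. diam_weight s (U (g n)))"
      by (rule sum.cong) (auto simp: V_def)
    also have "\<dots> = (\<Sum>i\<in>g ` ({..<N} \<inter> f ` I). diam_weight s (U i))"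
    proof -
      have "inj_on g ({..<N} \<inter> f ` I)" unfolding g_def by (rule inj_on_inv_into) auto
      then show ?thesis by (simp add: sum.reindex)
    qed
    also have "\<dots> \<le> K" by (rule sum) (use g in auto)
    finally show "(\<Sum>n<N. diam_weight s (V n)) \<le> K" .
  qed
  finally show ?thesis .
qed

lemma hausdorff_measure_eq_0I:
  assumes "\<And>d e. 0 < d \<Longrightarrow> 0 < e \<Longrightarrow> hausdorff_pre_measure s d A \<le> ennreal e"
  shows "hausdorff_measure s A = 0"
proof -
  have "hausdorff_pre_measure s d A \<le> 0" if "0 < d" for d
  proof (rule ennreal_le_epsilon)
    fix e :: real assume "0 < e"
    then show "hausdorff_pre_measure s d A \<le> 0 + ennreal e" using assms[OF that] by simp
  qed
  then have "hausdorff_measure s A \<le> 0"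
    unfolding hausdorff_measure_def by (intro SUP_least) auto
  then show ?thesis by simp
qed

lemma hausdorff_measure_eq_0D:
  assumes "hausdorff_measure s A = 0" "0 < d" "0 < e"
  obtains U where "U \<in> delta_covers d A" "(\<Sum>i. diam_weight s (U i)) < ennreal e"
proof -
  have "hausdorff_pre_measure s d A \<le> hausdorff_measure s A"
    unfolding hausdorff_measure_def using \<open>0 < d\<close> by (intro SUP_upper) simp
  then have "hausdorff_pre_measure s d A < ennreal e" using assms by simp
  then show ?thesis using that unfolding hausdorff_pre_measure_def INF_less_iff by blast
qed

lemma hausdorff_dim_eqI:
  assumes "0 \<le> D" "\<And>s. D < s \<Longrightarrow> hausdorff_measure s A = 0"
    and "\<And>s. 0 \<le> s \<Longrightarrow> s < D \<Longrightarrow> hausdorff_measure s A \<noteq> 0"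
  shows "hausdorff_dim A = ereal D"
proof (rule antisym)
  show "hausdorff_dim A \<le> ereal D"
  proof (rule ereal_le_epsilon2)
    fix e :: real assume "0 < e"
    then have "D + e \<in> {s. 0 \<le> s \<and> hausdorff_measure s A = 0}" using assms(1,2) by simp
    then have "hausdorff_dim A \<le> ereal (D + e)" unfolding hausdorff_dim_def by (rule INF_lower)
    then show "hausdorff_dim A \<le> ereal D + ereal e" by simp
  qed
  show "ereal D \<le> hausdorff_dim A"
    unfolding hausdorff_dim_def
  proof (rule INF_greatest)
    fix s assume "s \<in> {s. 0 \<le> s \<and> hausdorff_measure s A = 0}"
    then show "ereal D \<le> ereal s" using assms(3)[of s] by (auto simp: not_less[symmetric])
  qed
qed

section \<open>Cylinders as base-m intervals\<close>

abbreviation digits :: "nat \<Rightarrow> nat \<Rightarrow> real \<Rightarrow> nat list" where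
  "digits m n x \<equiv> map (digit m x) [0..<n]"

lemma digit_letter_sequence:
  assumes "m > 1" "x \<in> {0..<1}" shows "digit m x \<in> letter_sequences m"
  using digit_expansion[OF assms] by (simp add: is_base_expansion_def letter_sequences_def)

lemma floor_power_Suc:
  assumes "m > 1" "x \<in> {0..<1}"
  shows "\<lfloor>real m ^ Suc n * x\<rfloor> = int m * \<lfloor>real m ^ n * x\<rfloor> + int (digit m x n)"
  using base_expansion_floor[OF assms(1) digit_expansion[OF assms], of n] by simp

text \<open>Identifies the cylinder of the first \<open>n\<close> digits with a half-open interval
  of length \<open>1 / m ^ n\<close>: division with remainder by \<open>m\<close> recovers the
  earlier floor and the last digit.\<close>

lemma digits_eq_iff_floor_eq:
  assumes "m > 1" "x \<in> {0..<1}" "y \<in> {0..<1}"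
  shows "digits m n x = digits m n y \<longleftrightarrow> \<lfloor>real m ^ n * x\<rfloor> = \<lfloor>real m ^ n * y\<rfloor>"
proof (induction n)
  case 0
  have "\<lfloor>x\<rfloor> = 0" "\<lfloor>y\<rfloor> = 0" using assms by (auto simp: floor_eq_iff)
  then show ?case by simp
next
  case (Suc n)
  define u v where "u = \<lfloor>real m ^ n * x\<rfloor>" and "v = \<lfloor>real m ^ n * y\<rfloor>"
  define a b where "a = digit m x n" and "b = digit m y n"
  have ab: "a < m" "b < m"
    using digit_letter_sequence[OF assms(1)] assms(2,3) by (auto simp: a_def b_def letter_sequences_def)
  have "int m * u + int a = int m * v + int b \<longleftrightarrow> u = v \<and> a = b"
  proof
    assume eq: "int m * u + int a = int m * v + int b"
    have "u = (int m * u + int a) div int m" "v = (int m * v + int b) div int m" using ab by simp_all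
    with eq have "u = v" by simp
    with eq show "u = v \<and> a = b" by simp
  qed simp
  moreover have "digits m (Suc n) x = digits m (Suc n) y \<longleftrightarrow> digits m n x = digits m n y \<and> a = b"
    by (simp add: a_def b_def)
  ultimately show ?case
    unfolding floor_power_Suc[OF assms(1,2)] floor_power_Suc[OF assms(1,3)] Suc.IH
      u_def[symmetric] v_def[symmetric] a_def[symmetric] b_def[symmetric] by blast
qed

lemma digits_eq_imp_dist_le:
  assumes "m > 1" "x \<in> {0..<1}" "y \<in> {0..<1}" "digits m n x = digits m n y"
  shows "\<bar>x - y\<bar> \<le> 1 / real m ^ n"
proof -
  have "\<lfloor>real m ^ n * x\<rfloor> = \<lfloor>real m ^ n * y\<rfloor>" using digits_eq_iff_floor_eq assms by blast
  then have "\<bar>real m ^ n * x - real m ^ n * y\<bar> \<le> 1" by linarith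
  then have "real m ^ n * \<bar>x - y\<bar> \<le> 1" by (simp add: abs_mult flip: right_diff_distrib)
  then show ?thesis using \<open>m > 1\<close> by (simp add: field_simps)
qed

text \<open>Scaled by \<open>m ^ n\<close>, all points lie within 1 of a chosen one, so their floors
  take at most three values.\<close>

lemma card_digits_le:
  assumes "m > 1" "A \<subseteq> {0..<1}" "\<And>x y. x \<in> A \<Longrightarrow> y \<in> A \<Longrightarrow> \<bar>x - y\<bar> \<le> 1 / real m ^ n"
  shows "finite (digits m n ` A) \<and> card (digits m n ` A) \<le> 3"
proof (cases "A = {}")
  case False
  then obtain z where z: "z \<in> A" by blast
  define f where "f x = \<lfloor>real m ^ n * x\<rfloor>" for x
  have "f ` A \<subseteq> {f z - 1..f z + 1}"
  proof (rule image_subsetI)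
    fix x assume "x \<in> A"
    then have "real m ^ n * \<bar>x - z\<bar> \<le> 1" using assms(3)[OF _ z] \<open>m > 1\<close> by (simp add: field_simps)
    then have "\<bar>real m ^ n * x - real m ^ n * z\<bar> \<le> 1" by (simp add: abs_mult flip: right_diff_distrib)
    then show "f x \<in> {f z - 1..f z + 1}" unfolding f_def atLeastAtMost_iff by linarith
  qed
  then have f: "finite (f ` A)" "card (f ` A) \<le> 3"
    using card_mono[of "{f z - 1..f z + 1}" "f ` A"] by (auto dest: finite_subset)
  have "digits m n x = digits m n (inv_into A f (f x))" if "x \<in> A" for x
  proof -
    have "inv_into A f (f x) \<in> A" "f (inv_into A f (f x)) = f x"
      using that by (simp_all add: inv_into_into f_inv_into_f)
    moreover have "x \<in> {0..<1}" "inv_into A f (f x) \<in> {0..<1}" using that calculation(1) assms(2) by blast+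
    ultimately show ?thesis using digits_eq_iff_floor_eq[OF \<open>m > 1\<close>] by (simp add: f_def)
  qed
  then have sub: "digits m n ` A \<subseteq> (\<lambda>u. digits m n (inv_into A f u)) ` f ` A"
    unfolding image_image by (intro image_subsetI image_eqI)
  show ?thesis
  proof
    show "finite (digits m n ` A)" using sub f(1) finite_subset by blast
    have "card (digits m n ` A) \<le> card ((\<lambda>u. digits m n (inv_into A f u)) ` f ` A)"
      using sub f(1) by (intro card_mono) auto
    also have "\<dots> \<le> card (f ` A)" using f(1) by (rule card_image_le)
    finally show "card (digits m n ` A) \<le> 3" using f(2) by linarith
  qed
qed simp

text \<open>A digit below \<open>m - 1\<close> makes the sum less than 1, a nonzero digit makes it
  positive, and excluding a tail of digits \<open>m - 1\<close> makes the sequence the expansion of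
  that sum.\<close>

lemma base_expansion_exists:
  assumes m: "m > 1" and a: "a \<in> letter_sequences m"
    and top: "\<not> (\<exists>N. \<forall>j\<ge>N. a j = m - 1)" and bot: "\<not> (\<exists>N. \<forall>j\<ge>N. a j = 0)"
  obtains x where "x \<in> {0<..<1}" "digit m x = a"
proof -
  define f where "f j = real (a j) / real m ^ (j + 1)" for j
  define g where "g j = real (m - 1) / real m ^ (j + 1)" for j
  have g: "g sums 1" unfolding g_def by (rule sums_top_digits[OF m])
  have le: "a j \<le> m - 1" for j using a m by (auto simp: letter_sequences_def less_Suc_eq_le[symmetric])
  have f: "0 \<le> f j" "f j \<le> g j" for j
    unfolding f_def g_def using le[of j] by (auto intro: divide_right_mono)
  have sum_f: "summable f"
    by (rule summable_comparison_test'[OF sums_summable[OF g], of 0]) (simp add: f)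
  define x where "x = suminf f"
  have f_sums: "f sums x" unfolding x_def by (rule summable_sums[OF sum_f])
  have exp: "is_base_expansion m x a"
    using f_sums top a unfolding is_base_expansion_def letter_sequences_def f_def by auto
  obtain i where "a i \<noteq> 0" using bot by blast
  then have "0 < f i" using m by (simp add: f_def)
  then have "0 < x" unfolding x_def by (intro suminf_pos2[OF sum_f]) (auto simp: f)
  obtain j where "a j \<noteq> m - 1" using top by blast
  then have "a j < m - 1" using le[of j] by simp
  then have "0 < g j - f j" using m by (simp add: f_def g_def divide_strict_right_mono)
  moreover have diff: "(\<lambda>j. g j - f j) sums (1 - x)" by (rule sums_diff[OF g f_sums])
  ultimately have "0 < suminf (\<lambda>j. g j - f j)"
    using f by (intro suminf_pos2[OF sums_summable[OF diff], of j]) auto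
  then have "x < 1" using diff by (simp add: sums_iff)
  have "x \<in> {0..<1}" using \<open>0 < x\<close> \<open>x < 1\<close> by simp
  have "digit m x = a"
    using ex1_base_expansion[OF m \<open>x \<in> {0..<1}\<close>] digit_expansion[OF m \<open>x \<in> {0..<1}\<close>] exp by blast
  then show ?thesis using that \<open>0 < x\<close> \<open>x < 1\<close> by simp
qed

text \<open>Rounds a diameter \<open>r\<close> to a power of \<open>M\<close>: the largest
  \<open>n\<close> with \<open>r \<le> 1 / M ^ n\<close> satisfies
  \<open>1 / M ^ Suc n \<le> r\<close>, which costs a factor \<open>M powr s\<close>. For
  \<open>r = 0\<close> and \<open>s > 0\<close> no largest level exists, and \<open>e\<close>
  absorbs a sufficiently deep one; for \<open>s = 0\<close> both powers are replaced by 1.\<close>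

lemma exists_level:
  fixes M s r e :: real
  assumes "M > 1" "0 \<le> s" "0 \<le> r" "r \<le> 1 / M ^ N" "0 < e"
  shows "\<exists>n\<ge>N. r \<le> 1 / M ^ n \<and> M powr - (s * n) \<le> M powr s * (if s = 0 then 1 else r powr s) + e"
proof (cases "s = 0 \<or> r = 0")
  case True
  show ?thesis
  proof (cases "s = 0")
    case True
    then show ?thesis using assms by (intro exI[of _ N]) auto
  next
    case False
    with True assms have "s > 0" "r = 0" by auto
    have "M powr - s < 1" using assms \<open>s > 0\<close> by (simp add: powr_less_one)
    then obtain n where n: "(M powr - s) ^ n < e" using real_arch_pow_inv[OF \<open>0 < e\<close>] by blast
    have "M powr - (s * (max n N)) = (M powr - s) ^ (max n N)"
      using assms by (simp add: powr_powr mult.commute flip: powr_realpow)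
    also have "\<dots> \<le> (M powr - s) ^ n"
      using \<open>M powr - s < 1\<close> by (intro power_decreasing) auto
    finally show ?thesis using n \<open>r = 0\<close> \<open>s > 0\<close> assms
      by (intro exI[of _ "max n N"]) auto
  qed
next
  case False
  with assms have "s > 0" "r > 0" by auto
  obtain n0 where n0: "1 / r < M ^ n0" using real_arch_pow[OF \<open>M > 1\<close>] by blast
  define S where "S = {n. r \<le> 1 / M ^ n}"
  have "n \<le> n0" if "n \<in> S" for n
  proof (rule ccontr)
    assume "\<not> n \<le> n0"
    then have "M ^ n0 \<le> M ^ n" using \<open>M > 1\<close> by (intro power_increasing) auto
    with n0 have "1 / r < M ^ n" by simp
    with that \<open>r > 0\<close> \<open>M > 1\<close> show False by (simp add: S_def field_simps)
  qed
  then have fin: "finite S" by (intro finite_subset[of S "{..n0}"]) auto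
  have "N \<in> S" using assms by (simp add: S_def)
  define n where "n = Max S"
  have "n \<in> S" "N \<le> n" using fin \<open>N \<in> S\<close> unfolding n_def by (auto intro: Max_in)
  have "Suc n \<notin> S" using Max_ge[OF fin, of "Suc n"] unfolding n_def by auto
  then have "1 / M ^ Suc n \<le> r" by (simp add: S_def)
  then have "(1 / M ^ Suc n) powr s \<le> r powr s"
    using \<open>M > 1\<close> \<open>s > 0\<close> by (intro powr_mono2) auto
  moreover have "(1 / M ^ Suc n) powr s = M powr - (s * Suc n)"
  proof -
    have "1 / M ^ Suc n = M powr - real (Suc n)" using \<open>M > 1\<close> by (simp only: powr_minus_divide powr_realpow)
    then show ?thesis by (simp only: powr_powr) (simp add: algebra_simps)
  qed
  ultimately have "M powr s * M powr - (s * Suc n) \<le> M powr s * r powr s"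
    by (intro mult_left_mono) auto
  moreover have "M powr s * M powr - (s * Suc n) = M powr - (s * n)"
    by (simp add: algebra_simps flip: powr_add)
  ultimately show ?thesis
    using \<open>n \<in> S\<close> \<open>N \<le> n\<close> \<open>s > 0\<close> \<open>0 < e\<close> by (intro exI[of _ n]) (auto simp: S_def)
qed

section \<open>Comparing word weights with Hausdorff measure\<close>

context markov_weights
begin

text \<open>A mass distribution argument: a set of diameter at most \<open>1 / m ^ n\<close> meets
  the points of \<open>B\<close> in at most three cylinders of level \<open>n\<close>, each of
  weight at most \<open>m powr - (s * n)\<close>. A cover with a small \<open>s\<close>-sum thus
  turns into a family of words of small weight.\<close>

lemma null_of_hausdorff_measure_0:
  assumes "m > 1" "0 \<le> s" "hausdorff_measure s A = 0" "B \<subseteq> A" "B \<subseteq> {0..<1}"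
    and decay: "\<And>x n. x \<in> B \<Longrightarrow> n \<ge> N \<Longrightarrow> mu (digits m n x) \<le> real m powr - (s * n)"
  shows "null (digit m ` B)"
  unfolding null_def
proof (intro allI impI)
  fix e :: real assume "e > 0"
  define M where "M = real m"
  define C where "C = M powr s"
  \<comment> \<open>The 3 counts cylinders per set, \<open>C\<close> pays for rounding diameters to
    powers of \<open>M\<close>, and the additional 1 for the slack terms, which are spread over the
    cover as \<open>e' * (1/2) ^ Suc i\<close>.\<close>
  define e' where "e' = e / (3 * (C + 1))"
  have "M > 1" using \<open>m > 1\<close> by (simp add: M_def)
  have "C > 0" using \<open>M > 1\<close> by (simp add: C_def)
  have "e' > 0" using \<open>e > 0\<close> \<open>C > 0\<close> by (simp add: e'_def)
  \<comment> \<open>The mesh \<open>1 / M ^ N\<close> allows all levels to be chosen at least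
    \<open>N\<close>, where \<open>decay\<close> is available.\<close>
  obtain U where U: "U \<in> delta_covers (1 / M ^ N) A" "(\<Sum>i. diam_weight s (U i)) < ennreal e'"
    by (rule hausdorff_measure_eq_0D[OF assms(3), of "1 / M ^ N" e']) (use \<open>M > 1\<close> \<open>e' > 0\<close> in auto)
  have U': "A \<subseteq> (\<Union>i. U i)" "\<And>i. bounded (U i)" "\<And>i. diameter (U i) \<le> 1 / M ^ N"
    using U(1) by (auto simp: delta_covers_def)
  have "\<exists>n\<ge>N. diameter (U i) \<le> 1 / M ^ n \<and>
      M powr - (s * n) \<le> C * (if s = 0 then 1 else diameter (U i) powr s) + e' * (1/2) ^ Suc i" for i
    unfolding C_def using \<open>M > 1\<close> \<open>0 \<le> s\<close> \<open>e' > 0\<close> U' by (intro exists_level) (auto simp: diameter_ge_0)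
  then obtain n where n: "\<And>i. n i \<ge> N" "\<And>i. diameter (U i) \<le> 1 / M ^ n i"
    "\<And>i. M powr - (s * n i) \<le> C * (if s = 0 then 1 else diameter (U i) powr s) + e' * (1/2) ^ Suc i"
    by metis
  define W where "W i = digits m (n i) ` (U i \<inter> B)" for i
  have W: "emeasure Mu (W i) \<le> 3 * (ennreal C * diam_weight s (U i) + ennreal (e' * (1/2) ^ Suc i))" for i
  proof (cases "U i = {}")
    case False
    have card: "finite (W i) \<and> card (W i) \<le> 3"
      unfolding W_def
    proof (rule card_digits_le[OF \<open>m > 1\<close>])
      show "U i \<inter> B \<subseteq> {0..<1}" using assms(5) by blast
      fix x y assume "x \<in> U i \<inter> B" "y \<in> U i \<inter> B"
      then have "dist x y \<le> diameter (U i)" using U'(2) by (intro diameter_bounded_bound) auto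
      then show "\<bar>x - y\<bar> \<le> 1 / real m ^ n i" using n(2)[of i] by (simp add: dist_real_def M_def)
    qed
    have "emeasure Mu (W i) = (\<Sum>w\<in>W i. ennreal (mu w))" using card by (intro emeasure_Mu_finite) auto
    also have "\<dots> \<le> (\<Sum>w\<in>W i. ennreal (M powr - (s * n i)))"
      using decay n(1) by (intro sum_mono ennreal_leI) (auto simp: W_def M_def)
    also have "\<dots> = of_nat (card (W i)) * ennreal (M powr - (s * n i))" by simp
    also have "\<dots> \<le> of_nat 3 * ennreal (M powr - (s * n i))"
      using card by (intro mult_right_mono of_nat_mono) auto
    also have "ennreal (M powr - (s * n i)) \<le> ennreal (C * (if s = 0 then 1 else diameter (U i) powr s) + e' * (1/2) ^ Suc i)"
      by (intro ennreal_leI n(3))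
    also have "\<dots> = ennreal C * diam_weight s (U i) + ennreal (e' * (1/2) ^ Suc i)"
      using False \<open>C > 0\<close> \<open>e' > 0\<close> by (simp add: diam_weight_def ennreal_plus ennreal_mult)
    finally show ?thesis by (simp add: mult_left_mono)
  qed (simp add: W_def)
  have "emeasure Mu (\<Union>i. W i) \<le> (\<Sum>i. emeasure Mu (W i))"
    by (rule emeasure_subadditive_countably) simp
  also have "\<dots> \<le> (\<Sum>i. 3 * (ennreal C * diam_weight s (U i) + ennreal (e' * (1/2) ^ Suc i)))"
    by (intro suminf_le W summableI)
  also have "\<dots> = 3 * (ennreal C * (\<Sum>i. diam_weight s (U i)) + (\<Sum>i. ennreal (e' * (1/2) ^ Suc i)))"
    by (simp only: ennreal_suminf_cmult suminf_add[OF summableI summableI, symmetric])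
  also have "(\<Sum>i. ennreal (e' * (1/2) ^ Suc i)) = ennreal e'"
    using sums_mult[OF power_half_series, of e'] \<open>e' > 0\<close>
    by (subst suminf_ennreal2) (auto simp: sums_iff)
  also have "3 * (ennreal C * (\<Sum>i. diam_weight s (U i)) + ennreal e') \<le> 3 * (ennreal C * ennreal e' + ennreal e')"
    using U(2) by (intro mult_left_mono add_right_mono) auto
  also have "\<dots> = ennreal (3 * (C * e' + e'))"
    using \<open>C > 0\<close> \<open>e' > 0\<close> by (simp add: ennreal_mult ennreal_plus)
  also have "3 * (C * e' + e') = e' * (3 * (C + 1))" by (simp add: algebra_simps)
  also have "\<dots> = e" using \<open>C > 0\<close> by (simp add: e'_def)
  finally have "emeasure Mu (\<Union>i. W i) \<le> ennreal e" .
  moreover have "\<exists>k. map a [0..<k] \<in> (\<Union>i. W i)" if a: "a \<in> digit m ` B" for a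
  proof -
    obtain x where x: "x \<in> B" "a = digit m x" using a by blast
    then obtain i where "x \<in> U i" using U'(1) \<open>B \<subseteq> A\<close> by blast
    with x have "map a [0..<n i] \<in> W i" by (auto simp: W_def)
    then show ?thesis by blast
  qed
  ultimately show "\<exists>W. (\<forall>a\<in>digit m ` B. \<exists>n. map a [0..<n] \<in> W) \<and> emeasure Mu W \<le> ennreal e"
    by (intro exI[of _ "\<Union>i. W i"] conjI ballI) simp_all
qed

text \<open>If a word \<open>w\<close> of length \<open>n\<close> weighs at least
  \<open>m powr - (s' * n)\<close>, its cylinder has weight at most
  \<open>mu w * \<theta> ^ n\<close> with \<open>\<theta> = m powr - (s - s')\<close>. On each level
  the weights sum to at most 1, so all such cylinders from level \<open>N\<close> on, overlaps
  included, cost at most a tail of a geometric series.\<close>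

lemma hausdorff_measure_0_of_weights:
  fixes s s' :: real
  assumes "m > 1" "A \<subseteq> {0..<1}" "s' < s" "0 < s"
    and large: "\<And>x. x \<in> A \<Longrightarrow> \<forall>\<^sub>F n in sequentially. real m powr - (s' * n) \<le> mu (digits m n x)"
  shows "hausdorff_measure s A = 0"
proof (rule hausdorff_measure_eq_0I)
  fix d e :: real assume "0 < d" "0 < e"
  define M where "M = real m"
  define \<theta> where "\<theta> = M powr - (s - s')"
  have "M > 1" using \<open>m > 1\<close> by (simp add: M_def)
  have \<theta>: "0 < \<theta>" "\<theta> < 1" using \<open>M > 1\<close> \<open>s' < s\<close> by (auto simp: \<theta>_def powr_less_one)
  have "\<forall>\<^sub>F n in sequentially. \<theta> ^ n * (1 / (1 - \<theta>)) < e"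
  proof (rule order_tendstoD)
    have "(\<lambda>n. \<theta> ^ n) \<longlonglongrightarrow> 0" using \<theta> by (intro LIMSEQ_power_zero) auto
    then show "(\<lambda>n. \<theta> ^ n * (1 / (1 - \<theta>))) \<longlonglongrightarrow> 0" by (rule tendsto_mult_left_zero)
  qed fact
  moreover have "\<forall>\<^sub>F n in sequentially. (1 / M) ^ n < d"
    using \<open>M > 1\<close> \<open>0 < d\<close> by (intro order_tendstoD[OF LIMSEQ_power_zero]) auto
  ultimately have "\<forall>\<^sub>F n in sequentially. \<theta> ^ n * (1 / (1 - \<theta>)) < e \<and> (1 / M) ^ n < d"
    by (rule eventually_conj)
  then obtain N where N: "\<theta> ^ N * (1 / (1 - \<theta>)) < e" "(1 / M) ^ N < d"
    unfolding eventually_sequentially by blast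
  define I where "I = {w. N \<le> length w \<and> w \<in> words m (length w) \<and> M powr - (s' * length w) \<le> mu w}"
  define U where "U w = {x\<in>{0..<1}. digits m (length w) x = w}" for w
  have dist_U: "dist x y \<le> 1 / M ^ length w" if "x \<in> U w" "y \<in> U w" for x y w
    using that digits_eq_imp_dist_le[OF \<open>m > 1\<close>, of x y "length w"] by (simp add: U_def dist_real_def M_def)
  have diam_U: "diameter (U w) \<le> 1 / M ^ length w" for w
    using \<open>M > 1\<close> dist_U by (intro diameter_le) (auto simp: dist_norm)
  have bounded_U: "bounded (U w)" for w
    by (rule bounded_subset[of "{0..1}"]) (auto simp: U_def)
  have weight_U: "diam_weight s (U w) \<le> ennreal (mu w * \<theta> ^ length w)" if "w \<in> I" for w
  proof -
    have "diameter (U w) powr s \<le> (1 / M ^ length w) powr s"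
      using \<open>0 < s\<close> diam_U bounded_U by (intro powr_mono2) (auto simp: diameter_ge_0)
    also have "1 / M ^ length w = M powr - real (length w)"
      using \<open>M > 1\<close> by (simp only: powr_minus_divide powr_realpow)
    also have "(M powr - real (length w)) powr s = M powr - (s' * length w) * M powr (- (s - s') * length w)"
      unfolding powr_powr powr_add[symmetric] by (simp add: algebra_simps)
    also have "M powr (- (s - s') * length w) = \<theta> ^ length w"
      using \<theta>(1) unfolding \<theta>_def powr_powr[symmetric] by (simp only: powr_realpow)
    also have "M powr - (s' * length w) * \<theta> ^ length w \<le> mu w * \<theta> ^ length w"
      using that \<theta> by (intro mult_right_mono) (auto simp: I_def)
    finally show ?thesis using \<open>0 < s\<close> by (simp add: diam_weight_def ennreal_leI)
  qed
  have "hausdorff_pre_measure s d A \<le> ennreal e"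
  proof (rule hausdorff_pre_measure_le)
    show "countable I" by simp
    show "A \<subseteq> (\<Union>w\<in>I. U w)"
    proof
      fix x assume x: "x \<in> A"
      obtain n where n: "n \<ge> N" "real m powr - (s' * n) \<le> mu (digits m n x)"
        using large[OF x] unfolding eventually_sequentially by (metis linear)
      have "x \<in> {0..<1}" using x assms(2) by blast
      with n map_in_words[OF digit_letter_sequence[OF \<open>m > 1\<close> this], of n]
      have "digits m n x \<in> I" "x \<in> U (digits m n x)" by (simp_all add: I_def U_def M_def)
      then show "x \<in> (\<Union>w\<in>I. U w)" by blast
    qed
    show "0 \<le> d" using \<open>0 < d\<close> by simp
    fix w assume "w \<in> I"
    then have "(1 / M) ^ length w \<le> (1 / M) ^ N"
      using \<open>M > 1\<close> by (intro power_decreasing) (auto simp: I_def)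
    then show "bounded (U w) \<and> diameter (U w) \<le> d"
      using bounded_U diam_U[of w] N(2) by (simp add: power_one_over)
  next
    fix F assume F: "finite F" "F \<subseteq> I"
    have mu_F: "0 \<le> mu w" if "w \<in> F" for w using that F mu_nonneg by (auto simp: I_def)
    have "(\<Sum>w\<in>F. diam_weight s (U w)) \<le> (\<Sum>w\<in>F. ennreal (mu w * \<theta> ^ length w))"
      using F by (intro sum_mono weight_U) auto
    also have "\<dots> = ennreal (\<Sum>w\<in>F. mu w * \<theta> ^ length w)"
      using \<theta> mu_F by (intro sum_ennreal) auto
    also have "(\<Sum>w\<in>F. mu w * \<theta> ^ length w) = (\<Sum>n\<in>length ` F. \<Sum>w\<in>{w\<in>F. length w = n}. mu w * \<theta> ^ length w)"
      by (rule sum.image_gen[OF F(1)])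
    also have "\<dots> \<le> (\<Sum>n\<in>length ` F. \<theta> ^ n)"
    proof (rule sum_mono)
      fix n
      have "(\<Sum>w\<in>{w\<in>F. length w = n}. mu w * \<theta> ^ length w) = (\<Sum>w\<in>{w\<in>F. length w = n}. mu w) * \<theta> ^ n"
        by (simp add: sum_distrib_right)
      also have "(\<Sum>w\<in>{w\<in>F. length w = n}. mu w) \<le> (\<Sum>w\<in>words m n. mu w)"
        using F by (intro sum_mono2 finite_words mu_nonneg) (auto simp: I_def)
      finally show "(\<Sum>w\<in>{w\<in>F. length w = n}. mu w * \<theta> ^ length w) \<le> \<theta> ^ n"
        using \<theta> by (simp add: sum_mu)
    qed
    also have "\<dots> = (\<Sum>n\<in>(\<lambda>w. length w - N) ` F. \<theta> ^ (n + N))"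
      by (rule sum.reindex_bij_witness[of _ "\<lambda>n. n + N" "\<lambda>n. n - N"]) (use F in \<open>auto simp: I_def\<close>)
    also have "\<dots> = \<theta> ^ N * (\<Sum>n\<in>(\<lambda>w. length w - N) ` F. \<theta> ^ n)"
      by (simp add: power_add sum_distrib_left mult.commute)
    also have "\<dots> \<le> \<theta> ^ N * (\<Sum>n. \<theta> ^ n)"
      using \<theta> F(1) by (intro mult_left_mono sum_le_suminf summable_geometric) auto
    also have "\<dots> = \<theta> ^ N * (1 / (1 - \<theta>))" using \<theta> by (simp add: suminf_geometric)
    also have "\<dots> \<le> e" using N(1) by simp
    finally show "(\<Sum>w\<in>F. diam_weight s (U w)) \<le> ennreal e"
      using ennreal_leI by auto
  qed
  then show "hausdorff_pre_measure s d A \<le> ennreal e" .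
qed

end

section \<open>Primitive matrices\<close>

lemma pow_mat_index_Suc:
  assumes "A \<in> carrier_mat m m" "i < m" "j < m"
  shows "(A ^\<^sub>m Suc n) $$ (i, j) = (\<Sum>c<m. (A ^\<^sub>m n) $$ (i, c) * A $$ (c, j))"
proof -
  have "A ^\<^sub>m n \<in> carrier_mat m m" using assms(1) by simp
  with assms show ?thesis
    by (simp add: scalar_prod_def atLeast0LessThan)
qed

lemma pow_mat_nonneg:
  fixes A :: "real mat"
  assumes "A \<in> carrier_mat m m" "nonneg_matrix A" "i < m" "j < m"
  shows "0 \<le> (A ^\<^sub>m n) $$ (i, j)"
  using assms(4)
proof (induction n arbitrary: j)
  case 0
  then show ?case using assms by simp
next
  case (Suc n)
  have "0 \<le> A $$ (c, j)" if "c < m" for c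
    using assms(1,2) that Suc.prems by (auto simp: nonneg_matrix_def)
  then show ?case using assms Suc
    by (simp only: pow_mat_index_Suc) (auto intro!: sum_nonneg mult_nonneg_nonneg)
qed

text \<open>Nonnegative terms cannot cancel, so positivity of an entry of a power is reachability in
  the graph of positive entries.\<close>

lemma pow_mat_Suc_pos_iff:
  fixes A :: "real mat"
  assumes A: "A \<in> carrier_mat m m" "nonneg_matrix A" and "i < m" "j < m"
  shows "0 < (A ^\<^sub>m Suc n) $$ (i, j) \<longleftrightarrow> (\<exists>c<m. 0 < (A ^\<^sub>m n) $$ (i, c) \<and> 0 < A $$ (c, j))"
proof -
  have A_ge_0: "0 \<le> A $$ (c, j)" if "c < m" for c
    using A that \<open>j < m\<close> by (auto simp: nonneg_matrix_def)
  have nonneg: "0 \<le> (A ^\<^sub>m n) $$ (i, c) * A $$ (c, j)" if "c < m" for c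
    using pow_mat_nonneg[OF A \<open>i < m\<close> that] A_ge_0[OF that] by simp
  define S where "S = (\<Sum>c<m. (A ^\<^sub>m n) $$ (i, c) * A $$ (c, j))"
  have "S = 0 \<longleftrightarrow> (\<forall>c\<in>{..<m}. (A ^\<^sub>m n) $$ (i, c) * A $$ (c, j) = 0)"
    unfolding S_def using nonneg by (intro sum_nonneg_eq_0_iff) auto
  moreover have "0 \<le> S" unfolding S_def using nonneg by (intro sum_nonneg) auto
  ultimately have "0 < S \<longleftrightarrow> (\<exists>c<m. (A ^\<^sub>m n) $$ (i, c) * A $$ (c, j) \<noteq> 0)"
    by (auto simp: less_le)
  then have "0 < (A ^\<^sub>m Suc n) $$ (i, j) \<longleftrightarrow> (\<exists>c<m. (A ^\<^sub>m n) $$ (i, c) * A $$ (c, j) \<noteq> 0)"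
    unfolding pow_mat_index_Suc[OF assms(1,3,4)] S_def .
  moreover have "(A ^\<^sub>m n) $$ (i, c) * A $$ (c, j) \<noteq> 0 \<longleftrightarrow> 0 < (A ^\<^sub>m n) $$ (i, c) \<and> 0 < A $$ (c, j)"
    if "c < m" for c
    using pow_mat_nonneg[OF A \<open>i < m\<close> that, of n] A_ge_0[OF that] by (auto simp: less_le)
  ultimately show ?thesis by blast
qed

text \<open>Transfers primitivity from \<open>R\<close> to its row-normalised matrix, which has the
  same positive entries.\<close>

lemma pow_mat_pos_cong:
  fixes A B :: "real mat"
  assumes "A \<in> carrier_mat m m" "B \<in> carrier_mat m m"
    and "nonneg_matrix A" "nonneg_matrix B"
    and "\<And>i j. i < m \<Longrightarrow> j < m \<Longrightarrow> 0 < A $$ (i, j) \<longleftrightarrow> 0 < B $$ (i, j)"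
    and "i < m" "j < m"
  shows "0 < (A ^\<^sub>m n) $$ (i, j) \<longleftrightarrow> 0 < (B ^\<^sub>m n) $$ (i, j)"
  using assms(7)
proof (induction n arbitrary: j)
  case 0
  then show ?case using assms by simp
next
  case (Suc n)
  then show ?case
    unfolding pow_mat_Suc_pos_iff[OF assms(1,3,6) Suc.prems] pow_mat_Suc_pos_iff[OF assms(2,4,6) Suc.prems]
    using assms(5) by blast
qed

text \<open>Equal row and column sums say that \<open>R\<close> can be the joint law of two
  consecutive letters of a stationary chain.\<close>

locale primitive_flow =
  fixes m :: nat and R :: "real mat" and k :: nat
  assumes m: "m > 1" and R_carrier: "R \<in> carrier_mat m m" and R_nonneg: "nonneg_matrix R"
    and k: "k > 0" and R_primitive: "pos_matrix (R ^\<^sub>m k)"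
    and R_total: "(\<Sum>i<m. \<Sum>j<m. R $$ (i, j)) = 1"
    and R_balanced: "\<forall>i<m. (\<Sum>j<m. R $$ (i, j)) = (\<Sum>j<m. R $$ (j, i))"
begin

definition q :: "nat \<Rightarrow> real" where "q i = (\<Sum>j<m. R $$ (i, j))"
definition Q :: "nat \<Rightarrow> nat \<Rightarrow> real" where "Q i j = R $$ (i, j) / q i"

abbreviation "Qm \<equiv> normalized_rows R"

lemma R_ge_0: "i < m \<Longrightarrow> j < m \<Longrightarrow> 0 \<le> R $$ (i, j)"
  using R_nonneg R_carrier by (auto simp: nonneg_matrix_def)

lemma R_pow_pos: "i < m \<Longrightarrow> j < m \<Longrightarrow> 0 < (R ^\<^sub>m k) $$ (i, j)"
  using R_primitive R_carrier by (auto simp: pos_matrix_def)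

text \<open>A positive diagonal entry of the \<open>k\<close>-th power needs a last step into
  \<open>i\<close>, hence a positive column sum, which equals the row sum.\<close>

lemma q_pos:
  assumes "i < m" shows "0 < q i"
proof -
  obtain n where n: "k = Suc n" using k by (cases k) auto
  have "0 < (R ^\<^sub>m Suc n) $$ (i, i)" using R_pow_pos[OF assms assms] by (simp only: n)
  then obtain c where "c < m" "0 < R $$ (c, i)"
    unfolding pow_mat_Suc_pos_iff[OF R_carrier R_nonneg assms assms] by blast
  then have "0 < (\<Sum>j<m. R $$ (j, i))"
    using R_ge_0 assms by (intro sum_pos2[of _ c]) auto
  then show ?thesis using R_balanced assms by (simp add: q_def)
qed

lemma row_sums_index: "i < m \<Longrightarrow> vec_index (row_sums R) i = q i"
  using R_carrier by (simp add: row_sums_def q_def)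

lemma Qm_index: "i < m \<Longrightarrow> j < m \<Longrightarrow> Qm $$ (i, j) = Q i j"
  using R_carrier by (simp add: normalized_rows_def Q_def row_sums_index)

lemma Qm_carrier: "Qm \<in> carrier_mat m m"
  using R_carrier by (simp add: normalized_rows_def)

lemma q_mult_Q: "i < m \<Longrightarrow> q i * Q i j = R $$ (i, j)"
  using q_pos[of i] by (simp add: Q_def)

sublocale markov_weights m q Q
proof
  show "i < m \<Longrightarrow> 0 \<le> q i" for i using q_pos by (simp add: less_imp_le)
  show "(\<Sum>i<m. q i) = 1" using R_total by (simp add: q_def)
  show "i < m \<Longrightarrow> j < m \<Longrightarrow> 0 \<le> Q i j" for i j
    using q_pos[of i] R_ge_0 by (simp add: Q_def)
  show "(\<Sum>j<m. Q i j) = 1" if "i < m" for i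
    using q_pos[OF that] by (simp add: Q_def q_def flip: sum_divide_distrib)
qed

lemma Q_pos_iff: "i < m \<Longrightarrow> j < m \<Longrightarrow> 0 < Q i j \<longleftrightarrow> 0 < R $$ (i, j)"
  using q_pos[of i] by (simp add: Q_def zero_less_divide_iff)

lemma Qm_nonneg: "nonneg_matrix Qm"
  using Qm_carrier Q_nonneg by (auto simp: nonneg_matrix_def Qm_index)

lemma Qm_pow_pos_iff:
  "i < m \<Longrightarrow> j < m \<Longrightarrow> 0 < (Qm ^\<^sub>m n) $$ (i, j) \<longleftrightarrow> 0 < (R ^\<^sub>m n) $$ (i, j)"
  using Qm_carrier R_carrier R_nonneg Qm_nonneg Q_pos_iff
  by (intro pow_mat_pos_cong[of _ m]) (auto simp: Qm_index)

lemma Qop_pow: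
  assumes "i < m" shows "(Qop ^^ n) g i = (\<Sum>j<m. (Qm ^\<^sub>m n) $$ (i, j) * g j)"
proof (induction n arbitrary: g)
  case 0
  have "(\<Sum>j<m. (Qm ^\<^sub>m 0) $$ (i, j) * g j) = (\<Sum>j<m. if j = i then g j else 0)"
    using assms Qm_carrier by (intro sum.cong) auto
  then show ?case using assms by simp
next
  case (Suc n)
  have "(Qop ^^ Suc n) g i = (Qop ^^ n) (Qop g) i" by (simp add: funpow_swap1)
  also have "\<dots> = (\<Sum>c<m. (Qm ^\<^sub>m n) $$ (i, c) * (\<Sum>j<m. Q c j * g j))"
    by (simp add: Suc.IH Qop_def[of g])
  also have "\<dots> = (\<Sum>c<m. \<Sum>j<m. (Qm ^\<^sub>m n) $$ (i, c) * Q c j * g j)"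
    by (simp add: sum_distrib_left mult.assoc)
  also have "\<dots> = (\<Sum>j<m. \<Sum>c<m. (Qm ^\<^sub>m n) $$ (i, c) * Q c j * g j)"
    by (rule sum.swap)
  also have "\<dots> = (\<Sum>j<m. (Qm ^\<^sub>m Suc n) $$ (i, j) * g j)"
  proof (rule sum.cong[OF refl])
    fix j assume "j \<in> {..<m}"
    then have "(Qm ^\<^sub>m Suc n) $$ (i, j) = (\<Sum>c<m. (Qm ^\<^sub>m n) $$ (i, c) * Q c j)"
      by (subst pow_mat_index_Suc[OF Qm_carrier assms]) (auto simp: Qm_index)
    then show "(\<Sum>c<m. (Qm ^\<^sub>m n) $$ (i, c) * Q c j * g j) = (Qm ^\<^sub>m Suc n) $$ (i, j) * g j"
      by (simp only: sum_distrib_right)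
  qed
  finally show ?case .
qed

lemma q_stationary: "j < m \<Longrightarrow> (\<Sum>i<m. q i * Q i j) = q j"
  using R_balanced by (simp add: q_mult_Q) (simp add: q_def)

lemma prob_Qm: "prob_matrix Qm"
  using Qm_nonneg Qm_carrier Q_sum by (auto simp: prob_matrix_def Qm_index)

lemma irreducible_Qm: "irreducible_matrix Qm"
  unfolding irreducible_matrix_def
  using Qm_carrier k R_pow_pos Qm_pow_pos_iff by auto

text \<open>Both \<open>k\<close> and \<open>Suc k\<close> are return times of every state: a path
  of length \<open>k\<close> reaches any predecessor \<open>c\<close> of \<open>i\<close>, and one
  further step leads from \<open>c\<close> to \<open>i\<close>.\<close>

lemma aperiodic_Qm: "aperiodic_matrix Qm"
  unfolding aperiodic_matrix_def
proof (intro allI impI)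
  fix i assume "i < dim_row Qm"
  then have i: "i < m" using Qm_carrier by simp
  let ?S = "{n. 0 < n \<and> 0 < (Qm ^\<^sub>m n) $$ (i, i)}"
  have "0 < (\<Sum>c<m. R $$ (c, i))" using q_pos[OF i] R_balanced i by (simp add: q_def)
  then obtain c where c: "c < m" "0 < R $$ (c, i)"
    by (metis (no_types, lifting) lessThan_iff linorder_not_less sum_nonpos)
  then have "0 < (R ^\<^sub>m Suc k) $$ (i, i)"
    unfolding pow_mat_Suc_pos_iff[OF R_carrier R_nonneg i i] using R_pow_pos[OF i] by blast
  then have "Suc k \<in> ?S" using Qm_pow_pos_iff[OF i i, of "Suc k"] by blast
  then have "Gcd ?S dvd Suc k" by (rule Gcd_dvd)
  moreover have "k \<in> ?S" using R_pow_pos[OF i i] Qm_pow_pos_iff[OF i i] k by blast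
  then have "Gcd ?S dvd k" by (rule Gcd_dvd)
  ultimately have "Gcd ?S dvd Suc k - k" by (rule dvd_diff_nat)
  then show "Gcd ?S = 1" by simp
qed

lemma stationary_Qm: "stationary_vector Qm (row_sums R)"
proof -
  have dim: "row_sums R \<in> carrier_vec m" using R_carrier by (simp add: row_sums_def)
  have "transpose_mat Qm *\<^sub>v row_sums R = row_sums R"
  proof (rule eq_vecI)
    fix j assume "j < dim_vec (row_sums R)"
    then have j: "j < m" using dim by simp
    have "vec_index (transpose_mat Qm *\<^sub>v row_sums R) j = (\<Sum>i<m. Q i j * q i)"
      using j dim Qm_carrier by (simp add: scalar_prod_def atLeast0LessThan Qm_index row_sums_index)
    then show "vec_index (transpose_mat Qm *\<^sub>v row_sums R) j = vec_index (row_sums R) j"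
      using q_stationary[OF j] j by (simp add: row_sums_index mult.commute)
  qed (use dim Qm_carrier in auto)
  then show ?thesis
    using dim Qm_carrier q_nonneg q_sum by (auto simp: stationary_vector_def prob_vector_def row_sums_index)
qed

lemma pos_row_sums: "pos_vector (row_sums R)"
proof -
  have "row_sums R \<in> carrier_vec m" using R_carrier by (simp add: row_sums_def)
  then show ?thesis using q_pos by (auto simp: pos_vector_def row_sums_index)
qed

definition \<delta> :: real where "\<delta> = Min (($$) (Qm ^\<^sub>m k) ` ({..<m} \<times> {..<m}))"

sublocale mixing_chain m q Q k "\<lambda>i j. (Qm ^\<^sub>m k) $$ (i, j)" \<delta>
proof
  have fin: "finite (($$) (Qm ^\<^sub>m k) ` ({..<m} \<times> {..<m}))" by simp
  have ne: "($$) (Qm ^\<^sub>m k) ` ({..<m} \<times> {..<m}) \<noteq> {}" using m by auto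
  show "0 < \<delta>" using R_pow_pos Qm_pow_pos_iff by (auto simp: \<delta>_def Min_gr_iff[OF fin ne])
  show "i < m \<Longrightarrow> j < m \<Longrightarrow> \<delta> \<le> (Qm ^\<^sub>m k) $$ (i, j)" for i j
    unfolding \<delta>_def by (rule Min_le[OF fin]) auto
qed (fact q_stationary k Qop_pow)+

end

section \<open>The dimension of the frequency set\<close>

lemma eventually_Suc_SucD:
  assumes "\<forall>\<^sub>F n in sequentially. A (Suc (Suc n))"
  shows "\<forall>\<^sub>F n in sequentially. A n"
proof -
  have "\<forall>\<^sub>F n in sequentially. A (Suc n)"
    using assms eventually_sequentially_Suc[of "\<lambda>n. A (Suc n)"] by blast
  then show ?thesis using eventually_sequentially_Suc[of A] by blast
qed

locale coded_flow = primitive_flow + block_times l "\<lambda>i. t (Suc i)" \<epsilon>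
  for l :: nat and t :: "nat \<Rightarrow> nat \<Rightarrow> nat" and \<epsilon> :: real +
  fixes P :: "nat list \<Rightarrow> nat list \<Rightarrow> real"
  assumes l: "l \<ge> 1" and t_1: "\<forall>n\<ge>1. t 1 n = n"
    and P: "\<forall>\<alpha>\<in>words m l. \<forall>\<beta>\<in>words m l. P \<alpha> \<beta> = (\<Prod>i<l. R $$ (\<alpha> ! i, \<beta> ! i))"
begin

sublocale block_chain m q Q k "\<lambda>i j. (Qm ^\<^sub>m k) $$ (i, j)" \<delta> l "\<lambda>i. t (Suc i)" \<epsilon> ..

definition source :: "(nat \<Rightarrow> nat) \<Rightarrow> nat \<Rightarrow> nat list" where
  "source a n = map (\<lambda>i. a (t i n)) [1..<l + 1]"

definition target :: "(nat \<Rightarrow> nat) \<Rightarrow> nat \<Rightarrow> nat list" where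
  "target a n = map (\<lambda>i. a (t i n + 1)) [1..<l + 1]"

text \<open>The digit sequences of the points of the frequency set, described without reference to
  real numbers or to tails.\<close>

definition typical :: "(nat \<Rightarrow> nat) set" where
  "typical = {a\<in>letter_sequences m. \<forall>\<alpha>\<in>words m l. \<forall>\<beta>\<in>words m l.
     (\<lambda>n. (\<Sum>k=1..n. of_bool (source a k = \<alpha> \<and> target a k = \<beta>)) / real n) \<longlonglongrightarrow> P \<alpha> \<beta>}"

lemma source_nth: "i < l \<Longrightarrow> source a n ! i = a (t (Suc i) n)"
  by (simp add: source_def del: upt_Suc)

lemma target_nth: "i < l \<Longrightarrow> target a n ! i = a (Suc (t (Suc i) n))"
  by (simp add: target_def del: upt_Suc)

lemma length_source_target [simp]: "length (source a n) = l" "length (target a n) = l"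
  by (simp_all add: source_def target_def)

lemma source_target_words:
  "a \<in> letter_sequences m \<Longrightarrow> source a n \<in> words m l \<and> target a n \<in> words m l"
  by (auto simp: source_def target_def words_def letter_sequences_def)

lemma frequency_set_eq: "frequency_set m l t P = {x\<in>{0<..<1}. digit m x \<in> typical}"
proof -
  have count: "real (transition_count m l t \<alpha> \<beta> x n) =
      (\<Sum>k=1..n. of_bool (source (digit m x) k = \<alpha> \<and> target (digit m x) k = \<beta>))" for \<alpha> \<beta> x n
  proof -
    have "{k. 0 < k \<and> k \<le> n \<and> source (digit m x) k = \<alpha> \<and> target (digit m x) k = \<beta>} =
        {1..n} \<inter> {k. source (digit m x) k = \<alpha> \<and> target (digit m x) k = \<beta>}" by auto
    moreover have "transition_count m l t \<alpha> \<beta> x n =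
        card {k. 0 < k \<and> k \<le> n \<and> source (digit m x) k = \<alpha> \<and> target (digit m x) k = \<beta>}"
      by (simp only: transition_count_def source_def target_def)
    ultimately show ?thesis by (simp add: sum_of_bool_eq)
  qed
  have "digit m x \<in> letter_sequences m" if "x \<in> {0<..<1}" for x
    using digit_letter_sequence[OF m, of x] that by simp
  then show ?thesis by (auto simp: frequency_set_def typical_def count)
qed

text \<open>Reading the word pair (\<alpha>, \<beta>) is a product of indicators, one for each
  coordinate, and the indicator at coordinate \<open>i\<close> has stationary mean
  \<open>R $$ (\<alpha> ! i, \<beta> ! i)\<close>. The product hypothesis on \<open>P\<close>
  therefore makes \<open>P \<alpha> \<beta>\<close> the block mean.\<close>

lemma null_atypical: "null (letter_sequences m - typical)"
proof -
  define \<phi> where "\<phi> \<alpha> \<beta> i x y = (of_bool (x = \<alpha> ! i \<and> y = \<beta> ! i) :: real)" for \<alpha> \<beta> :: "nat list" and i x y :: nat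
  define A where "A \<alpha> \<beta> = {a\<in>letter_sequences m.
    \<not> (\<lambda>n. (\<Sum>x=1..n. block (\<phi> \<alpha> \<beta>) x a) / real n) \<longlonglongrightarrow> block_mean (\<phi> \<alpha> \<beta>)}" for \<alpha> \<beta>
  have block: "block (\<phi> \<alpha> \<beta>) n a = of_bool (source a n = \<alpha> \<and> target a n = \<beta>)"
    if "\<alpha> \<in> words m l" "\<beta> \<in> words m l" for \<alpha> \<beta> a n
  proof -
    have len: "length \<alpha> = l" "length \<beta> = l" using that by (auto simp: words_def)
    have "source a n = \<alpha> \<and> target a n = \<beta> \<longleftrightarrow>
        (\<forall>i<l. a (t (Suc i) n) = \<alpha> ! i \<and> a (Suc (t (Suc i) n)) = \<beta> ! i)"
      using len by (auto simp: list_eq_iff_nth_eq source_nth target_nth)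
    moreover have "block (\<phi> \<alpha> \<beta>) n a =
        of_bool (\<forall>i<l. a (t (Suc i) n) = \<alpha> ! i \<and> a (Suc (t (Suc i) n)) = \<beta> ! i)"
      by (auto simp: block_def \<phi>_def prod_zero_iff)
    ultimately show ?thesis by simp
  qed
  have mean: "block_mean (\<phi> \<alpha> \<beta>) = P \<alpha> \<beta>" if "\<alpha> \<in> words m l" "\<beta> \<in> words m l" for \<alpha> \<beta>
  proof -
    have "pair_mean (\<phi> \<alpha> \<beta> i) = R $$ (\<alpha> ! i, \<beta> ! i)" if "i < l" for i
    proof -
      have lt: "\<alpha> ! i < m" "\<beta> ! i < m"
        using \<open>\<alpha> \<in> words m l\<close> \<open>\<beta> \<in> words m l\<close> \<open>i < l\<close> nth_mem[of i \<alpha>] nth_mem[of i \<beta>] by (auto simp: words_def subset_iff)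
      have "pair_mean (\<phi> \<alpha> \<beta> i) = (\<Sum>x<m. \<Sum>y<m. if y = \<beta> ! i then (if x = \<alpha> ! i then q x * Q x y else 0) else 0)"
        unfolding pair_mean_def \<phi>_def by (intro sum.cong) auto
      also have "\<dots> = q (\<alpha> ! i) * Q (\<alpha> ! i) (\<beta> ! i)" using lt by simp
      finally show ?thesis using lt by (simp add: q_mult_Q)
    qed
    then show ?thesis using P that by (simp add: block_mean_def)
  qed
  have "null (A \<alpha> \<beta>)" for \<alpha> \<beta>
    unfolding A_def by (rule null_block_average) (simp add: \<phi>_def)
  then have "null (\<Union>\<alpha>\<in>words m l. \<Union>\<beta>\<in>words m l. A \<alpha> \<beta>)"
    by (intro null_UN_countable countable_finite finite_words)
  then show ?thesis
  proof (rule null_subset, intro subsetI)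
    fix a assume a: "a \<in> letter_sequences m - typical"
    then obtain \<alpha> \<beta> where w: "\<alpha> \<in> words m l" "\<beta> \<in> words m l"
      and "\<not> (\<lambda>n. (\<Sum>k=1..n. of_bool (source a k = \<alpha> \<and> target a k = \<beta>)) / real n) \<longlonglongrightarrow> P \<alpha> \<beta>"
      unfolding typical_def by blast
    with a have "a \<in> A \<alpha> \<beta>" by (simp add: A_def block[OF w] mean[OF w])
    with w show "a \<in> (\<Union>\<alpha>\<in>words m l. \<Union>\<beta>\<in>words m l. A \<alpha> \<beta>)" by blast
  qed
qed

text \<open>Since \<open>t 1 n = n\<close>, summing the block frequencies over all but the first coordinate gives the
  frequencies of the two-letter words.\<close>

lemma typical_average:
  assumes a: "a \<in> typical"
  shows "(\<lambda>n. (\<Sum>k=1..n. g (a k) (a (Suc k))) / real n) \<longlonglongrightarrow> (\<Sum>i<m. \<Sum>j<m. R $$ (i, j) * g i j)"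
proof -
  have aL: "a \<in> letter_sequences m" using a by (simp add: typical_def)
  define N where "N \<alpha> \<beta> n = (\<Sum>k=1..n. of_bool (source a k = \<alpha> \<and> target a k = \<beta>)) / real n" for \<alpha> \<beta> n
  have "(\<lambda>n. \<Sum>\<alpha>\<in>words m l. \<Sum>\<beta>\<in>words m l. g (\<alpha> ! 0) (\<beta> ! 0) * N \<alpha> \<beta> n)
      \<longlonglongrightarrow> (\<Sum>\<alpha>\<in>words m l. \<Sum>\<beta>\<in>words m l. g (\<alpha> ! 0) (\<beta> ! 0) * P \<alpha> \<beta>)"
    unfolding N_def using a by (intro tendsto_intros) (auto simp: typical_def)
  moreover have "(\<Sum>\<alpha>\<in>words m l. \<Sum>\<beta>\<in>words m l. g (\<alpha> ! 0) (\<beta> ! 0) * N \<alpha> \<beta> n) =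
      (\<Sum>k=1..n. g (a k) (a (Suc k))) / real n" for n
  proof -
    have "(\<Sum>\<alpha>\<in>words m l. \<Sum>\<beta>\<in>words m l. g (\<alpha> ! 0) (\<beta> ! 0) * of_bool (source a k = \<alpha> \<and> target a k = \<beta>)) =
        g (a k) (a (Suc k))" if "k \<in> {1..n}" for k
    proof -
      have "(\<Sum>\<alpha>\<in>words m l. \<Sum>\<beta>\<in>words m l. g (\<alpha> ! 0) (\<beta> ! 0) * of_bool (source a k = \<alpha> \<and> target a k = \<beta>)) =
        (\<Sum>\<alpha>\<in>words m l. \<Sum>\<beta>\<in>words m l. if \<beta> = target a k then (if \<alpha> = source a k then g (\<alpha> ! 0) (\<beta> ! 0) else 0) else 0)"
        by (intro sum.cong) auto
      also have "\<dots> = g (source a k ! 0) (target a k ! 0)"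
        using source_target_words[OF aL, of k] by (simp add: finite_words)
      also have "\<dots> = g (a k) (a (Suc k))"
        using l t_1 that by (simp add: source_nth target_nth)
      finally show ?thesis .
    qed
    then have "(\<Sum>k=1..n. g (a k) (a (Suc k))) =
        (\<Sum>k=1..n. \<Sum>\<alpha>\<in>words m l. \<Sum>\<beta>\<in>words m l. g (\<alpha> ! 0) (\<beta> ! 0) * of_bool (source a k = \<alpha> \<and> target a k = \<beta>))"
      by (intro sum.cong) auto
    also have "\<dots> = (\<Sum>\<alpha>\<in>words m l. \<Sum>\<beta>\<in>words m l. \<Sum>k=1..n. g (\<alpha> ! 0) (\<beta> ! 0) * of_bool (source a k = \<alpha> \<and> target a k = \<beta>))"
      by (subst sum.swap, intro sum.cong refl, rule sum.swap)
    finally show ?thesis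
      by (simp only: N_def sum_distrib_left sum_divide_distrib times_divide_eq_right)
  qed
  moreover have "(\<Sum>\<alpha>\<in>words m l. \<Sum>\<beta>\<in>words m l. g (\<alpha> ! 0) (\<beta> ! 0) * P \<alpha> \<beta>) = (\<Sum>i<m. \<Sum>j<m. R $$ (i, j) * g i j)"
  proof -
    obtain l' where l': "l = Suc l'" using l by (cases l) auto
    define f where "f i x y = (if i = 0 then g x y * R $$ (x, y) else R $$ (x, y))" for i x y :: nat
    have "g (\<alpha> ! 0) (\<beta> ! 0) * P \<alpha> \<beta> = (\<Prod>i<l. f i (\<alpha> ! i) (\<beta> ! i))"
      if "\<alpha> \<in> words m l" "\<beta> \<in> words m l" for \<alpha> \<beta>
      using P that by (simp add: l' f_def prod.lessThan_Suc_shift mult.assoc del: prod.lessThan_Suc)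
    then have "(\<Sum>\<alpha>\<in>words m l. \<Sum>\<beta>\<in>words m l. g (\<alpha> ! 0) (\<beta> ! 0) * P \<alpha> \<beta>) =
        (\<Sum>\<alpha>\<in>words m l. \<Sum>\<beta>\<in>words m l. \<Prod>i<l. f i (\<alpha> ! i) (\<beta> ! i))"
      by (intro sum.cong) auto
    also have "\<dots> = (\<Sum>i<m. \<Sum>j<m. g i j * R $$ (i, j))"
      unfolding sum_words_prod by (simp add: l' f_def R_total prod.lessThan_Suc_shift del: prod.lessThan_Suc)
    finally show ?thesis by (simp add: mult.commute)
  qed
  ultimately show ?thesis by simp
qed

text \<open>On a constant tail the pair \<open>(c, c)\<close> would have frequency 1, but its
  frequency is \<open>R $$ (c, c) \<le> q c\<close>, and \<open>q c < 1\<close> because some other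
  letter has positive mass.\<close>

lemma typical_not_eventually_const:
  assumes a: "a \<in> typical" shows "\<not> (\<exists>N. \<forall>j\<ge>N. a j = c)"
proof
  assume "\<exists>N. \<forall>j\<ge>N. a j = c"
  then obtain N where N: "\<And>j. j \<ge> N \<Longrightarrow> a j = c" by blast
  then have c: "c < m" using a by (auto simp: typical_def letter_sequences_def)
  define g where "g i j = (of_bool (i = c \<and> j = c) :: real)" for i j
  have "(\<lambda>n. 1 - real N * (1 / real n)) \<longlonglongrightarrow> 1 - real N * 0"
    by (intro tendsto_intros lim_1_over_n)
  then have lim: "(\<lambda>n. 1 - real N * (1 / real n)) \<longlonglongrightarrow> 1" by simp
  have "1 \<le> (\<Sum>i<m. \<Sum>j<m. R $$ (i, j) * g i j)"
  proof (rule tendsto_le[OF sequentially_bot typical_average[OF a, of g] lim])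
    show "\<forall>\<^sub>F n in sequentially. 1 - real N * (1 / real n) \<le> (\<Sum>k=1..n. g (a k) (a (Suc k))) / real n"
      using eventually_gt_at_top[of "0 :: nat"]
    proof eventually_elim
      case (elim n)
      have "real n - real N \<le> real (card {Suc N..n})" by simp
      also have "\<dots> = (\<Sum>k\<in>{Suc N..n}. g (a k) (a (Suc k)))" using N by (simp add: g_def)
      also have "\<dots> \<le> (\<Sum>k=1..n. g (a k) (a (Suc k)))" by (intro sum_mono2) (auto simp: g_def)
      finally have "(real n - real N) / real n \<le> (\<Sum>k=1..n. g (a k) (a (Suc k))) / real n"
        by (rule divide_right_mono) simp
      moreover have "(real n - real N) / real n = 1 - real N * (1 / real n)"
        using elim by (simp add: diff_divide_distrib)
      ultimately show ?case by simp
    qed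
  qed
  also have "\<dots> = (\<Sum>i<m. \<Sum>j<m. if j = c then (if i = c then R $$ (i, j) else 0) else 0)"
    unfolding g_def by (intro sum.cong) auto
  also have "\<dots> = R $$ (c, c)" using c by simp
  also have "\<dots> \<le> q c"
    unfolding q_def using c R_ge_0 by (intro member_le_sum[of c _ "\<lambda>j. R $$ (c, j)"]) auto
  finally have "1 \<le> q c" .
  moreover obtain c' where c': "c' < m" "c' \<noteq> c"
    using m that[of 0] that[of 1] by (cases "c = 0") auto
  have "q c + q c' = (\<Sum>i\<in>{c, c'}. q i)" using c' by simp
  also have "\<dots> \<le> (\<Sum>i<m. q i)" using c c' q_nonneg by (intro sum_mono2) auto
  ultimately show False using q_sum q_pos[OF c'(1)] by simp
qed

lemma typical_subset_image: "typical \<subseteq> digit m ` frequency_set m l t P"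
proof
  fix a assume a: "a \<in> typical"
  then have "a \<in> letter_sequences m" by (simp add: typical_def)
  then obtain x where "x \<in> {0<..<1}" "digit m x = a"
    by (rule base_expansion_exists[OF m _ typical_not_eventually_const[OF a] typical_not_eventually_const[OF a]])
  then show "a \<in> digit m ` frequency_set m l t P" using a by (auto simp: frequency_set_eq)
qed

section \<open>Entropy and the two bounds for the dimension\<close>

text \<open>The factor \<open>Q i j\<close> enforces the convention \<open>0 ln 0 = 0\<close>,
  whatever value \<open>ln\<close> has at 0.\<close>

definition entropy :: real where
  "entropy = - (\<Sum>i<m. \<Sum>j<m. q i * Q i j * ln (Q i j))"

lemma entropy_nonneg: "0 \<le> entropy"
proof -
  have "q i * Q i j * ln (Q i j) \<le> 0" if "i < m" "j < m" for i j
  proof -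
    have "Q i j \<le> (\<Sum>j<m. Q i j)" using that Q_nonneg by (intro member_le_sum) auto
    then have "ln (Q i j) \<le> 0 \<or> Q i j = 0" using Q_nonneg[OF that] Q_sum[OF that(1)] by (auto simp: less_le)
    then show ?thesis using q_nonneg[OF that(1)] Q_nonneg[OF that] by (auto intro: mult_nonneg_nonpos)
  qed
  then have "(\<Sum>i<m. \<Sum>j<m. q i * Q i j * ln (Q i j)) \<le> 0" by (intro sum_nonpos) auto
  then show ?thesis by (simp add: entropy_def)
qed

lemma ln_m_pos: "0 < ln (real m)" using m by simp

lemma eventually_mu_le:
  assumes a: "a \<in> typical" and "0 \<le> s" "s * ln (real m) < entropy"
  shows "\<forall>\<^sub>F n in sequentially. mu (map a [0..<n]) \<le> real m powr - (s * n)"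
proof -
  define h where "h = s * ln (real m)"
  define c where "c = (h + entropy) / 2"
  have c: "h < c" "c < entropy" using assms by (auto simp: c_def h_def)
  \<comment> \<open>The default 0 at vanishing entries keeps \<open>Q x y \<le> exp (g x y)\<close>
    true, which suffices for an upper bound on \<open>mu\<close>.\<close>
  define g where "g i j = (if 0 < Q i j then ln (Q i j) else 0)" for i j
  have a_lt: "a i < m" for i using a by (auto simp: typical_def letter_sequences_def)
  have "(\<Sum>i<m. \<Sum>j<m. R $$ (i, j) * g i j) = - entropy"
    unfolding entropy_def g_def
    using Q_nonneg by (auto simp: q_mult_Q[symmetric] less_le intro!: sum.cong)
  then have "(\<lambda>n. (\<Sum>k=1..n. g (a k) (a (Suc k))) / real n) \<longlonglongrightarrow> - entropy"
    using typical_average[OF a, of g] by simp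
  then have "\<forall>\<^sub>F n in sequentially. (\<Sum>k=1..n. g (a k) (a (Suc k))) / real n < - c"
    using c by (intro order_tendstoD) auto
  \<comment> \<open>The margin \<open>(c - h) * n\<close> absorbs the shift from \<open>n\<close>
    counted transitions to words of length \<open>n + 2\<close>.\<close>
  moreover have "\<forall>\<^sub>F n in sequentially. 2 * h / (c - h) \<le> real n"
    using filterlim_real_sequentially by (simp add: filterlim_at_top)
  ultimately have "\<forall>\<^sub>F n in sequentially. mu (map a [0..<Suc (Suc n)]) \<le> real m powr - (s * Suc (Suc n))"
    using eventually_gt_at_top[of "0 :: nat"]
  proof eventually_elim
    case (elim n)
    have Q_le: "Q x y \<le> exp (g x y)" if "x < m" "y < m" for x y
      using Q_nonneg[OF that] by (auto simp: g_def less_le)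
    have "q (a 0) * Q (a 0) (a 1) \<le> 1"
    proof (rule mult_le_one)
      show "Q (a 0) (a 1) \<le> 1"
        using member_le_sum[of "a 1" "{..<m}" "Q (a 0)"] Q_sum[of "a 0"] Q_nonneg a_lt by auto
    qed (simp_all add: q_le_1 Q_nonneg a_lt)
    moreover have "(\<Prod>k=1..n. Q (a k) (a (Suc k))) \<le> (\<Prod>k=1..n. exp (g (a k) (a (Suc k))))"
      by (rule prod_mono) (simp add: Q_le Q_nonneg a_lt)
    moreover have "0 \<le> (\<Prod>k=1..n. Q (a k) (a (Suc k)))"
      by (rule prod_nonneg) (simp add: Q_nonneg a_lt)
    ultimately have "mu (map a [0..<Suc (Suc n)]) \<le> 1 * (\<Prod>k=1..n. exp (g (a k) (a (Suc k))))"
      unfolding mu_Suc_Suc by (intro mult_mono) auto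
    also have "\<dots> = exp (\<Sum>k=1..n. g (a k) (a (Suc k)))" by (simp add: exp_sum)
    also have "\<dots> \<le> exp (- (h * real (Suc (Suc n))))"
    proof -
      have "(\<Sum>k=1..n. g (a k) (a (Suc k))) \<le> - c * real n"
        using elim by (simp add: field_simps)
      moreover have "2 * h \<le> real n * (c - h)" using elim c by (simp add: field_simps)
      ultimately show ?thesis by (simp add: algebra_simps)
    qed
    also have "\<dots> = real m powr - (s * Suc (Suc n))"
      using m by (simp add: powr_def h_def algebra_simps)
    finally show ?case .
  qed
  then show ?thesis
    by (rule eventually_Suc_SucD)
qed

text \<open>Measure zero would make the typical sequences null; the atypical ones are null in any
  case, so all letter sequences would be null.\<close>

lemma hausdorff_measure_nonzero:
  assumes "0 \<le> s" "s * ln (real m) < entropy"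
  shows "hausdorff_measure s (frequency_set m l t P) \<noteq> 0"
proof
  assume zero: "hausdorff_measure s (frequency_set m l t P) = 0"
  \<comment> \<open>The weight bound starts at a level depending on the point. Fixing that level
    gives the uniformity the transfer requires, at the price of a countable union.\<close>
  define B where "B N = {x\<in>frequency_set m l t P. \<forall>n\<ge>N. mu (digits m n x) \<le> real m powr - (s * n)}" for N
  have "null (digit m ` B N)" for N
    by (rule null_of_hausdorff_measure_0[OF m assms(1) zero]) (auto simp: B_def frequency_set_eq)
  then have "null (\<Union>N. digit m ` B N)" by (rule null_UN)
  moreover have "typical \<subseteq> (\<Union>N. digit m ` B N)"
  proof
    fix a assume a: "a \<in> typical"
    then obtain x where x: "x \<in> frequency_set m l t P" "a = digit m x" using typical_subset_image by blast
    obtain N where "\<And>n. n \<ge> N \<Longrightarrow> mu (digits m n x) \<le> real m powr - (s * n)"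
      using eventually_mu_le[OF a assms] unfolding eventually_sequentially x(2) by blast
    with x show "a \<in> (\<Union>N. digit m ` B N)" by (auto simp: B_def)
  qed
  ultimately have "null typical" by (rule null_subset)
  then have "null (typical \<union> (letter_sequences m - typical))" using null_atypical by (rule null_Un)
  then have "null (letter_sequences m)" by (rule null_subset) auto
  then show False using not_null_sequences by simp
qed

text \<open>Entries \<open>Q i j = 0\<close> may still be used infinitely often along a typical sequence, so the
  covering argument runs with the positive matrix \<open>\<theta> Q + (1 - \<theta>) / m\<close>, which costs at most
  \<open>- ln \<theta>\<close> per letter.\<close>

lemma hausdorff_measure_zero:
  assumes "entropy < s * ln (real m)"
  shows "hausdorff_measure s (frequency_set m l t P) = 0"
proof -
  \<comment> \<open>Four equal margins: the loss from \<theta>, the convergence of averages, the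
    initial factor \<open>c\<close>, and the strict inequality \<open>s' < s\<close>.\<close>
  define \<tau> where "\<tau> = (s * ln (real m) - entropy) / 4"
  define \<theta> where "\<theta> = exp (- \<tau>)"
  define s' where "s' = (entropy + 3 * \<tau>) / ln (real m)"
  define Q' where "Q' i j = \<theta> * Q i j + (1 - \<theta>) / real m" for i j
  \<comment> \<open>A lower bound for the first letter and first transition: the uniform initial
    mass times the least value that an entry of \<open>Q'\<close> can have.\<close>
  define c where "c = 1 / real m * ((1 - \<theta>) / real m)"
  have "\<tau> > 0" using assms by (simp add: \<tau>_def)
  have \<theta>: "0 < \<theta>" "\<theta> < 1" using \<open>\<tau> > 0\<close> by (simp_all add: \<theta>_def)
  have s'_ln: "s' * ln (real m) = entropy + 3 * \<tau>" using ln_m_pos by (simp add: s'_def)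
  have "s' * ln (real m) < s * ln (real m)" using \<open>\<tau> > 0\<close> by (simp add: s'_ln \<tau>_def field_simps)
  then have "s' < s" using ln_m_pos by simp
  have "0 \<le> s'" using entropy_nonneg ln_m_pos \<open>\<tau> > 0\<close> by (simp add: s'_def)
  have c_pos: "0 < c" using \<theta> m by (simp add: c_def)
  have base: "(1 - \<theta>) / real m \<le> Q' i j" if "i < m" "j < m" for i j
    using \<theta> Q_nonneg[OF that] by (simp add: Q'_def)
  have Q'_pos: "0 < Q' i j" if "i < m" "j < m" for i j
    using less_le_trans[OF _ base[OF that]] \<theta> m by simp
  interpret pert: markov_weights m "\<lambda>_. 1 / real m" Q'
  proof
    show "(\<Sum>j<m. Q' i j) = 1" if "i < m" for i
      using m Q_sum[OF that] by (simp add: Q'_def sum.distrib flip: sum_distrib_left)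
    show "0 \<le> Q' i j" if "i < m" "j < m" for i j
      using Q'_pos[OF that] by (rule less_imp_le)
  qed (use m in simp_all)
  have "(\<Sum>i<m. \<Sum>j<m. R $$ (i, j) * ln (Q' i j)) \<ge> (\<Sum>i<m. \<Sum>j<m. R $$ (i, j) * (ln (Q i j) - \<tau>))"
  proof (intro sum_mono)
    fix i j assume "i \<in> {..<m}" "j \<in> {..<m}"
    then have ij: "i < m" "j < m" by auto
    show "R $$ (i, j) * (ln (Q i j) - \<tau>) \<le> R $$ (i, j) * ln (Q' i j)"
    \<comment> \<open>Where \<open>R\<close> vanishes both sides are 0; elsewhere
      \<open>Q' i j \<ge> \<theta> * Q i j\<close> and
      \<open>ln \<theta> = - \<tau>\<close>.\<close>
    proof (cases "R $$ (i, j) = 0")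
      case False
      then have "0 < Q i j" using R_ge_0[OF ij] Q_pos_iff[OF ij] by simp
      then have "ln (Q i j) - \<tau> = ln (\<theta> * Q i j)" using \<theta> by (simp add: ln_mult \<theta>_def)
      also have "\<dots> \<le> ln (Q' i j)"
        using \<open>0 < Q i j\<close> \<theta> m by (subst ln_le_cancel_iff) (auto simp: Q'_def intro!: add_pos_nonneg)
      finally show ?thesis using R_ge_0[OF ij] by (rule mult_left_mono)
    qed simp
  qed
  also have "(\<Sum>i<m. \<Sum>j<m. R $$ (i, j) * (ln (Q i j) - \<tau>)) = - entropy - \<tau>"
    using R_total by (simp add: entropy_def q_mult_Q right_diff_distrib sum_subtractf flip: sum_distrib_right)
  finally have mean: "- entropy - \<tau> \<le> (\<Sum>i<m. \<Sum>j<m. R $$ (i, j) * ln (Q' i j))" .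
  have "\<forall>\<^sub>F n in sequentially. real m powr - (s' * n) \<le> pert.mu (digits m n x)"
    if x: "x \<in> frequency_set m l t P" for x
  proof -
    define a where "a = digit m x"
    have a: "a \<in> typical" using x by (simp add: frequency_set_eq a_def)
    then have a_lt: "a i < m" for i by (auto simp: typical_def letter_sequences_def)
    have "\<forall>\<^sub>F n in sequentially. - entropy - 2 * \<tau> < (\<Sum>k=1..n. ln (Q' (a k) (a (Suc k)))) / real n"
      using mean \<open>\<tau> > 0\<close> by (intro order_tendstoD[OF typical_average[OF a, of "\<lambda>i j. ln (Q' i j)"]]) auto
    moreover have "\<forall>\<^sub>F n in sequentially. - ln c / \<tau> \<le> real n"
      using filterlim_real_sequentially by (simp add: filterlim_at_top)
    ultimately have "\<forall>\<^sub>F n in sequentially. real m powr - (s' * Suc (Suc n)) \<le> pert.mu (map a [0..<Suc (Suc n)])"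
      using eventually_gt_at_top[of "0 :: nat"]
    proof eventually_elim
      case (elim n)
      have sum: "(- entropy - 2 * \<tau>) * real n \<le> (\<Sum>k=1..n. ln (Q' (a k) (a (Suc k))))"
        using elim by (simp add: field_simps)
      have "- ln c \<le> \<tau> * real n" using elim \<open>\<tau> > 0\<close> by (simp add: field_simps)
      moreover have "0 \<le> 2 * (entropy + 3 * \<tau>)" using entropy_nonneg \<open>\<tau> > 0\<close> by simp
      ultimately have "- ((entropy + 3 * \<tau>) * real (Suc (Suc n))) \<le> ln c + (- entropy - 2 * \<tau>) * real n"
        by (simp add: algebra_simps)
      then have le: "- ((entropy + 3 * \<tau>) * real (Suc (Suc n))) \<le> ln c + (\<Sum>k=1..n. ln (Q' (a k) (a (Suc k))))"
        using sum by linarith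
      have "real m powr - (s' * Suc (Suc n)) = exp (- ((s' * ln (real m)) * real (Suc (Suc n))))"
        using m by (simp add: powr_def algebra_simps)
      also have "\<dots> \<le> exp (ln c + (\<Sum>k=1..n. ln (Q' (a k) (a (Suc k)))))"
        unfolding s'_ln using le by simp
      also have "\<dots> = c * (\<Prod>k=1..n. Q' (a k) (a (Suc k)))"
        using c_pos Q'_pos a_lt by (simp add: exp_add exp_sum)
      also have "\<dots> \<le> 1 / real m * Q' (a 0) (a 1) * (\<Prod>k=1..n. Q' (a k) (a (Suc k)))"
        unfolding c_def using base[OF a_lt a_lt] Q'_pos a_lt
        by (intro mult_right_mono mult_left_mono prod_nonneg) (auto intro: less_imp_le)
      also have "\<dots> = pert.mu (map a [0..<Suc (Suc n)])" by (rule pert.mu_Suc_Suc[symmetric])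
      finally show ?case .
    qed
    then show ?thesis
      unfolding a_def[symmetric]
      by (rule eventually_Suc_SucD)
  qed
  then show ?thesis
    using \<open>0 \<le> s'\<close> \<open>s' < s\<close>
    by (intro pert.hausdorff_measure_0_of_weights[OF m _ \<open>s' < s\<close>]) (auto simp: frequency_set_eq)
qed

lemma hausdorff_dim_frequency_set:
  "hausdorff_dim (frequency_set m l t P) = ereal (entropy / ln (real m))"
proof (rule hausdorff_dim_eqI)
  show "0 \<le> entropy / ln (real m)" using entropy_nonneg ln_m_pos by simp
  show "hausdorff_measure s (frequency_set m l t P) = 0" if "entropy / ln (real m) < s" for s
    using that ln_m_pos by (intro hausdorff_measure_zero) (simp add: field_simps)
  show "hausdorff_measure s (frequency_set m l t P) \<noteq> 0" if "0 \<le> s" "s < entropy / ln (real m)" for s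
    using that ln_m_pos by (intro hausdorff_measure_nonzero) (simp_all add: field_simps)
qed

end

theorem proposition2p7:
  fixes m l :: nat
    and t :: "nat \<Rightarrow> nat \<Rightarrow> nat"
    and P :: "nat list \<Rightarrow> nat list \<Rightarrow> real"
    and R :: "real mat"
  assumes "m > 1" and "l \<ge> 1"
    and "admissible_times l t"
    and "\<forall>k\<ge>1. t 1 k = k"
    and "\<forall>\<alpha>\<in>words m l. \<forall>\<beta>\<in>words m l. 0 \<le> P \<alpha> \<beta>"
    and "(\<Sum>\<alpha>\<in>words m l. \<Sum>\<beta>\<in>words m l. P \<alpha> \<beta>) = 1"
    and "R \<in> carrier_mat m m" and "nonneg_matrix R"
    and "\<exists>k>0. pos_matrix (R ^\<^sub>m k)"
    and "(\<Sum>i<m. \<Sum>j<m. R $$ (i, j)) = 1"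
    and "\<forall>i<m. (\<Sum>j<m. R $$ (i, j)) = (\<Sum>j<m. R $$ (j, i))"
    and "\<forall>\<alpha>\<in>words m l. \<forall>\<beta>\<in>words m l. P \<alpha> \<beta> = (\<Prod>i<l. R $$ (\<alpha> ! i, \<beta> ! i))"
  shows "prob_matrix (normalized_rows R) \<and>
         irreducible_matrix (normalized_rows R) \<and>
         aperiodic_matrix (normalized_rows R) \<and>
         stationary_vector (normalized_rows R) (row_sums R) \<and>
         pos_vector (row_sums R) \<and>
         hausdorff_dim (frequency_set m l t P) =
           ereal (- (\<Sum>i<m. \<Sum>j<m. vec_index (row_sums R) i * normalized_rows R $$ (i, j)
                        * ln (normalized_rows R $$ (i, j))) / ln (real m))"
proof -
  obtain k where k: "k > 0" "pos_matrix (R ^\<^sub>m k)" using assms(9) by blast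
  obtain \<epsilon> where \<epsilon>: "block_times l (\<lambda>i. t (Suc i)) \<epsilon>"
    using assms(2-4) by (elim admissible_block_times)
  interpret times: block_times l "\<lambda>i. t (Suc i)" \<epsilon> by (rule \<epsilon>)
  interpret coded_flow m R k l t \<epsilon> P
    by unfold_locales (use assms k in auto)
  have "hausdorff_dim (frequency_set m l t P) =
      ereal (- (\<Sum>i<m. \<Sum>j<m. vec_index (row_sums R) i * Qm $$ (i, j) * ln (Qm $$ (i, j))) / ln (real m))"
    unfolding hausdorff_dim_frequency_set entropy_def by (simp add: row_sums_index Qm_index)
  then show ?thesis
    using prob_Qm irreducible_Qm aperiodic_Qm stationary_Qm pos_row_sums by blast
qed

end
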